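(* For every natural number $B$ there exists a reactive Turing machine $U_B$ such that for all reactive Turing machines $M$ for which $\mathcal{T}(M)$ has branching degree bounded by $B$, it holds that $\mathcal{T}(M)\leftrightarrow_b^\Delta\mathcal{T}([\mathit{Snd}_M\parallel U_B]_{\{u\}})$.
   Context: Fix a finite set $\mathcal{A}$ of action symbols and $\tau\notin\mathcal{A}$; $\mathcal{A}_\tau=\mathcal{A}\cup\{\tau\}$. Fix a finite set $\mathcal{D}$ of data symbols and a blank $\Box\notin\mathcal{D}$; $\mathcal{D}_\Box=\mathcal{D}\cup\{\Box\}$. Fix a finite set $\mathit{Chan}$ of channels containing a dedicated channel $u$; $\mathcal{A}$ contains $c!d$ and $c?d$ for $c\in\mathit{Chan}$, $d\in\mathcal{D}_\Box$. A transition system is $T=(S,\to,\uparrow,\downarrow)$ with $\to\subseteq S\times\mathcal{A}_\tau\times S$, initial state $\uparrow$, final states $\downarrow$; it has branching degree bounded by $B$ if every state has at most $B$ outgoing transitions (pairs $(a,t)$ with $s\xrightarrow{a}t$). The parallel composition $[T_1\parallel T_2]_C$ ($C\subseteq\mathit{Chan}$) of $T_i=(S_i,\to_i,\uparrow_i,\downarrow_i)$ has states $S_1\times S_2$, initial state $(\uparrow_1,\uparrow_2)$, final states $\downarrow_1\times\downarrow_2$, and $(s_1,s_2)\xrightarrow{a}(s_1',s_2')$ iff $a\notin\{c!d,c?d\mid c\in C,d\in\mathcal{D}_\Box\}$ and either one component makes an $a$-step while the other stays put, or $a=\tau$ and for some $c\in C$, $d\in\mathcal{D}_\Box$ one component does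 $c!d$ while the other does $c?d$. A reactive Turing machine (RTM) is $M=(S,\to,\uparrow,\downarrow)$ with $S$ finite, $\uparrow\in S$, $\downarrow\subseteq S$, $\to\subseteq S\times\mathcal{D}_\Box\times\mathcal{A}_\tau\times\mathcal{D}_\Box\times\{L,R\}\times S$ (write $s\xrightarrow{d/a/e,X}t$). A tape instance is a finite sequence over $\mathcal{D}_\Box$ and marked symbols $\check d$ with exactly one marked symbol, identified modulo blanks at the ends; for $\delta\in\mathcal{D}_\Box^*$, $\overleftarrow{\delta}$ (resp. $\overrightarrow{\delta}$) is $\delta$ with rightmost (resp. leftmost) symbol marked, or $\check\Box$ if $\delta$ empty. $\mathcal{T}(M)$ has states the configurations $(s,\delta)$, transitions $(s,\delta_L\check d\delta_R)\xrightarrow{a}(t,\overleftarrow{\delta_L}e\delta_R)$ iff $s\xrightarrow{d/a/e,L}t$ and $(s,\delta_L\check d\delta_R)\xrightarrow{a}(t,\delta_Le\overrightarrow{\delta_R})$ iff $s\xrightarrow{d/a/e,R}t$, initial state $(\uparrow,\check\Box)$, final states $\{(s,\delta)\mid s\in\downarrow\}$. For RTMs, $\mathcal{T}([M_1\parallel M_2]_C)=[\mathcal{T}(M_1)\parallel\mathcal{T}(M_2)]_C$. Fix a Gödel numbering of RTMs. For an RTM $M$, $\mathit{Snd}_M$ denotes a deterministic RTM with no other behaviour than outputting the Gödel number of $M$, in an appropriate representation, along channel $u$ (via actions $u!d$), after which it halts in its unique final state. Divergence-preserving branching bisimilarity: write $s\xrightarrow{(a)}t$ if $s\xrightarrow{a}t$,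 or $a=\tau$ and $s=t$; $\twoheadrightarrow$ / $\twoheadrightarrow^+$ are the reflexive-transitive / transitive closures of $\xrightarrow{\tau}$. A relation $\mathcal{R}$ is a divergence-preserving branching bisimulation from $T_1$ to $T_2$ if $s_1\mathcal{R}s_2$ implies: (1) if $s_1\xrightarrow{a}s_1'$ then $s_2\twoheadrightarrow s_2''\xrightarrow{(a)}s_2'$ with $s_1\mathcal{R}s_2''$, $s_1'\mathcal{R}s_2'$; (2) symmetrically; (3) if $s_1$ final then $s_2\twoheadrightarrow s_2'$, $s_2'$ final, $s_1\mathcal{R}s_2'$; (4) symmetrically; (5) if $s_1=s_{1,0}\xrightarrow{\tau}s_{1,1}\xrightarrow{\tau}\cdots$ is infinite with all $s_{1,i}\mathcal{R}s_2$ then $s_2\twoheadrightarrow^+s_2'$ with $s_{1,i}\mathcal{R}s_2'$ for some $i$; (6) symmetrically. $T_1\leftrightarrow_b^\Delta T_2$ if such a relation relates the initial states.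
   Formalization: The formal theorem additionally assumes that no reachable configuration of M performs an action u!d or u?d on the dedicated channel u; otherwise the claim fails, since the composition over {u} blocks these actions. *)

theory Defs
  imports Complex_Main "HOL-Library.Countable" "HOL-Library.Nat_Bijection"
begin

text \<open>
  Data symbols are the elements of a (nonempty) finite type \<open>'d\<close>, and \<open>'d option\<close> adds the blank
  as \<open>None\<close>. Channels are the elements of a finite type \<open>'c\<close>. Action symbols are the elements of a
  finite set \<open>A\<close> of type \<open>('a, 'c, 'd) action set\<close> that contains all \<open>Send c d\<close> and \<open>Recv c d\<close>;
  \<open>Plain\<close> provides the action symbols that are not communication actions. A label is an element
  of an option type, with \<open>None\<close> for the silent step.
\<close>

datatype ('a, 'c, 'd) action = Send 'c "'d option" | Recv 'c "'d option" | Plain 'a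

instance action :: (countable, countable, countable) countable
  by countable_datatype

datatype direction = MoveL | MoveR

abbreviation blank :: "'d option" where "blank \<equiv> None"

abbreviation tau :: "'l option" where "tau \<equiv> None"

definition comm_actions :: "'c set \<Rightarrow> ('a, 'c, 'd) action set" where
  "comm_actions C = {Send c d | c d. c \<in> C} \<union> {Recv c d | c d. c \<in> C}"


section \<open>Transition systems\<close>

record ('s, 'l) ts =
  states :: "'s set"
  transitions :: "('s \<times> 'l option \<times> 's) set"
  start :: 's
  finals :: "'s set"

definition branching_bounded :: "nat \<Rightarrow> ('s, 'l) ts \<Rightarrow> bool" where
  "branching_bounded B T \<longleftrightarrow>
     (\<forall>s \<in> states T. finite {(a, t). (s, a, t) \<in> transitions T} \<and> card {(a, t). (s, a, t) \<in> transitions T} \<le> B)"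

definition step_rel :: "('s, 'l) ts \<Rightarrow> ('s \<times> 's) set" where
  "step_rel T = {(s, t). \<exists>a. (s, a, t) \<in> transitions T}"

definition reachable :: "('s, 'l) ts \<Rightarrow> 's set" where
  "reachable T = {s. (start T, s) \<in> (step_rel T)\<^sup>*}"

definition par :: "'c set \<Rightarrow> ('s, ('a, 'c, 'd) action) ts \<Rightarrow> ('t, ('a, 'c, 'd) action) ts
    \<Rightarrow> ('s \<times> 't, ('a, 'c, 'd) action) ts" where
  "par C T1 T2 = \<lparr>
     states = states T1 \<times> states T2,
     transitions = {((s1, s2), a, (s1', s2')) | s1 s2 a s1' s2'.
        s1 \<in> states T1 \<and> s2 \<in> states T2 \<and> s1' \<in> states T1 \<and> s2' \<in> states T2 \<and>
        a \<notin> Some ` comm_actions C \<and>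
        ((s1, a, s1') \<in> transitions T1 \<and> s2' = s2 \<or>
         (s2, a, s2') \<in> transitions T2 \<and> s1' = s1 \<or>
         a = tau \<and> (\<exists>c \<in> C. \<exists>d.
           (s1, Some (Send c d), s1') \<in> transitions T1 \<and> (s2, Some (Recv c d), s2') \<in> transitions T2 \<or>
           (s1, Some (Recv c d), s1') \<in> transitions T1 \<and> (s2, Some (Send c d), s2') \<in> transitions T2))},
     start = (start T1, start T2),
     finals = finals T1 \<times> finals T2 \<rparr>"


section \<open>Divergence-preserving branching bisimilarity\<close>

definition tau_rel :: "('s, 'l) ts \<Rightarrow> ('s \<times> 's) set" where
  "tau_rel T = {(s, t). (s, tau, t) \<in> transitions T}"

definition opt_step :: "('s, 'l) ts \<Rightarrow> 's \<Rightarrow> 'l option \<Rightarrow> 's \<Rightarrow> bool" where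
  "opt_step T s a t \<longleftrightarrow> (s, a, t) \<in> transitions T \<or> a = tau \<and> s = t"

definition dpbb_half :: "('s, 'l) ts \<Rightarrow> ('t, 'l) ts \<Rightarrow> ('s \<times> 't) set \<Rightarrow> bool" where
  "dpbb_half T1 T2 R \<longleftrightarrow> (\<forall>s1 s2. (s1, s2) \<in> R \<longrightarrow>
     (\<forall>a s1'. (s1, a, s1') \<in> transitions T1 \<longrightarrow>
        (\<exists>s2'' s2'. (s2, s2'') \<in> (tau_rel T2)\<^sup>* \<and> opt_step T2 s2'' a s2' \<and>
           (s1, s2'') \<in> R \<and> (s1', s2') \<in> R)) \<and>
     (s1 \<in> finals T1 \<longrightarrow>
        (\<exists>s2'. (s2, s2') \<in> (tau_rel T2)\<^sup>* \<and> s2' \<in> finals T2 \<and> (s1, s2') \<in> R)) \<and>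
     (\<forall>f :: nat \<Rightarrow> 's.
        f 0 = s1 \<and> (\<forall>i. (f i, f (Suc i)) \<in> tau_rel T1) \<and> (\<forall>i. (f i, s2) \<in> R) \<longrightarrow>
        (\<exists>s2'. (s2, s2') \<in> (tau_rel T2)\<^sup>+ \<and> (\<exists>i. (f i, s2') \<in> R))))"

definition dpbb :: "('s, 'l) ts \<Rightarrow> ('t, 'l) ts \<Rightarrow> ('s \<times> 't) set \<Rightarrow> bool" where
  "dpbb T1 T2 R \<longleftrightarrow>
     R \<subseteq> states T1 \<times> states T2 \<and> dpbb_half T1 T2 R \<and> dpbb_half T2 T1 (R\<inverse>)"

definition dpbb_equiv :: "('s, 'l) ts \<Rightarrow> ('t, 'l) ts \<Rightarrow> bool" where
  "dpbb_equiv T1 T2 \<longleftrightarrow> (\<exists>R. dpbb T1 T2 R \<and> (start T1, start T2) \<in> R)"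


section \<open>Reactive Turing machines\<close>

text \<open>States are drawn from \<open>nat\<close>; up to renaming this covers every finite set of states.\<close>

record ('a, 'c, 'd) rtm =
  rstates :: "nat set"
  rtrans :: "(nat \<times> 'd option \<times> ('a, 'c, 'd) action option \<times> 'd option \<times> direction \<times> nat) set"
  rinit :: nat
  rfinals :: "nat set"

definition is_rtm :: "('a, 'c, 'd) action set \<Rightarrow> ('a, 'c, 'd) rtm \<Rightarrow> bool" where
  "is_rtm A M \<longleftrightarrow>
     finite (rstates M) \<and> rinit M \<in> rstates M \<and> rfinals M \<subseteq> rstates M \<and>
     rtrans M \<subseteq> rstates M \<times> UNIV \<times> insert tau (Some ` A) \<times> UNIV \<times> UNIV \<times> rstates M"

text \<open>
  The triple \<open>(l, d, r)\<close> stands for the sequence \<open>l\<close>, marked \<open>d\<close>, \<open>r\<close>, with \<open>l\<close> and \<open>r\<close> both read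
  from left to right. Two such sequences are the same tape instance if they agree after
  the unmarked blanks at both ends have been removed.
\<close>

type_synonym 'd raw_tape = "'d option list \<times> 'd option \<times> 'd option list"

fun trim :: "'d raw_tape \<Rightarrow> 'd raw_tape" where
  "trim (l, d, r) = (dropWhile (\<lambda>x. x = blank) l, d, rev (dropWhile (\<lambda>x. x = blank) (rev r)))"

definition tape_eq :: "'d raw_tape \<Rightarrow> 'd raw_tape \<Rightarrow> bool" where
  "tape_eq x y \<longleftrightarrow> trim x = trim y"

quotient_type 'd tape = "'d raw_tape" / tape_eq
  by (rule equivpI) (auto simp: reflp_def symp_def transp_def tape_eq_def)

lift_definition Tape :: "'d option list \<Rightarrow> 'd option \<Rightarrow> 'd option list \<Rightarrow> 'd tape"
  is "\<lambda>l d r. (l, d, r)" .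

definition left_of :: "'d option list \<Rightarrow> 'd option list \<Rightarrow> 'd tape" where
  "left_of l r = (if l = [] then Tape [] blank r else Tape (butlast l) (last l) r)"

definition right_of :: "'d option list \<Rightarrow> 'd option list \<Rightarrow> 'd tape" where
  "right_of l r = (if r = [] then Tape l blank [] else Tape l (hd r) (tl r))"

definition ts_of :: "('a, 'c, 'd) rtm \<Rightarrow> (nat \<times> 'd tape, ('a, 'c, 'd) action) ts" where
  "ts_of M = \<lparr>
     states = rstates M \<times> UNIV,
     transitions =
       {((s, Tape l d r), a, (t, left_of l (e # r))) | s l d r a t e. (s, d, a, e, MoveL, t) \<in> rtrans M} \<union>
       {((s, Tape l d r), a, (t, right_of (l @ [e]) r)) | s l d r a t e. (s, d, a, e, MoveR, t) \<in> rtrans M},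
     start = (rinit M, Tape [] blank []),
     finals = rfinals M \<times> UNIV \<rparr>"


section \<open>Goedel numbers and the machine that sends them\<close>

text \<open>
  The function \<open>to_nat\<close> is an unspecified injection, so here it is applied only to components
  that range over a fixed finite set; all else is coded by the explicit bijections
  \<open>prod_encode\<close> and \<open>set_encode\<close>.
\<close>

fun trans_code :: "nat \<times> ('d::finite) option \<times> ('a::countable, 'c::finite, 'd) action option
    \<times> 'd option \<times> direction \<times> nat \<Rightarrow> nat" where
  "trans_code (s, d, a, e, X, t) =
     prod_encode (s, prod_encode (to_nat d, prod_encode (to_nat a, prod_encode (to_nat e,
       prod_encode (case X of MoveL \<Rightarrow> 0 | MoveR \<Rightarrow> 1, t)))))"

definition godel :: "('a::countable, 'c::finite, 'd::finite) rtm \<Rightarrow> nat" where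
  "godel M = prod_encode (set_encode (rstates M), prod_encode (set_encode (trans_code ` rtrans M),
     prod_encode (rinit M, set_encode (rfinals M))))"

text \<open>
  A number is sent in unary, as repetitions of one arbitrary but fixed data symbol, and a
  final blank marks the end.
\<close>

definition unary :: "nat \<Rightarrow> 'd option list" where
  "unary n = replicate n (Some (SOME d. True)) @ [blank]"

definition Snd :: "'c \<Rightarrow> ('a::countable, 'c::finite, 'd::finite) rtm \<Rightarrow> ('a, 'c, 'd) rtm" where
  "Snd u M = (let w = unary (godel M) in \<lparr>
     rstates = {0..length w},
     rtrans = {(i, blank, Some (Send u (w ! i)), blank, MoveR, Suc i) | i. i < length w},
     rinit = 0,
     rfinals = {length w} \<rparr>)"


section \<open>Basic properties\<close>

lemma inj_trans_code:
  "inj (trans_code :: nat \<times> ('d::finite) option \<times> ('a::countable, 'c::finite, 'd) action option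
    \<times> 'd option \<times> direction \<times> nat \<Rightarrow> nat)"
proof (rule injI)
  fix x y :: "nat \<times> 'd option \<times> ('a, 'c, 'd) action option \<times> 'd option \<times> direction \<times> nat"
  assume "trans_code x = trans_code y"
  then show "x = y"
    by (cases x; cases y) (auto split: direction.splits)
qed

lemma finite_rtrans:
  fixes M :: "('a, 'c, 'd::finite) rtm"
  assumes "finite A" "is_rtm A M"
  shows "finite (rtrans M)"
proof -
  have "finite (UNIV :: direction set)"
    by (rule finite_subset[of _ "{MoveL, MoveR}"]) (use direction.exhaust in auto)
  then have "finite (rstates M \<times> (UNIV :: 'd option set) \<times> insert tau (Some ` A) \<times>
      (UNIV :: 'd option set) \<times> (UNIV :: direction set) \<times> rstates M)"
    using assms by (intro finite_cartesian_product) (auto simp: is_rtm_def)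
  then show ?thesis
    using assms(2) unfolding is_rtm_def by (meson finite_subset)
qed

lemma godel_inj:
  fixes A :: "('a::countable, 'c::finite, 'd::finite) action set"
  assumes "finite A"
  shows "inj_on godel {M. is_rtm A M}"
proof (rule inj_onI)
  fix M N :: "('a, 'c, 'd) rtm"
  assume M: "M \<in> {M. is_rtm A M}" and N: "N \<in> {M. is_rtm A M}" and eq: "godel M = godel N"
  have fin: "finite (rstates K)" "finite (rfinals K)" "finite (trans_code ` rtrans K)"
    if "is_rtm A K" for K :: "('a, 'c, 'd) rtm"
    using that finite_rtrans[OF assms that] by (auto simp: is_rtm_def intro: finite_subset)
  have "set_encode (rstates M) = set_encode (rstates N)"
    "set_encode (trans_code ` rtrans M) = set_encode (trans_code ` rtrans N)"
    "rinit M = rinit N" "set_encode (rfinals M) = set_encode (rfinals N)"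
    using eq by (auto simp: godel_def)
  then have "rstates M = rstates N" "rtrans M = rtrans N" "rinit M = rinit N" "rfinals M = rfinals N"
    using M N fin by (auto simp: set_encode_eq inj_image_eq_iff[OF inj_trans_code])
  then show "M = N" by simp
qed

lemma is_rtm_Snd: "comm_actions {u} \<subseteq> A \<Longrightarrow> is_rtm A (Snd u M)"
  by (auto simp: is_rtm_def Snd_def Let_def comm_actions_def)

lemma Snd_deterministic:
  "(s, d, x) \<in> rtrans (Snd u M) \<Longrightarrow> (s, d, y) \<in> rtrans (Snd u M) \<Longrightarrow> x = y"
  by (auto simp: Snd_def Let_def)

lemma Snd_halts: "s \<in> rfinals (Snd u M) \<Longrightarrow> (s, x) \<notin> rtrans (Snd u M)"
  by (auto simp: Snd_def Let_def)

end

theory Submission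
  imports Defs
begin

text \<open>
  The universal machine is a register machine whose registers are kept in unary on interleaved tracks of
  the tape. It receives the Goedel number \<open>g\<close> of \<open>M\<close> and codes the configuration of \<open>M\<close> by one
  number \<open>c\<close>. In a loop, it computes from \<open>g\<close> and \<open>c\<close> the list of the labels of the transitions that
  are enabled in \<open>c\<close>, enters a control state that offers exactly these labels (finitely many such states
  suffice, since the list has at most \<open>B\<close> elements), and computes the next configuration from the index
  of the chosen transition. All other steps are silent, deterministic and terminate, so
  relating a configuration of \<open>M\<close> to all states from which such steps lead to its offering state
  gives a divergence-preserving branching bisimulation.
\<close>

section \<open>Tapes and deterministic silent steps\<close>

text \<open>Each menu of labels has to be offered by a single control state. Spreading the choice
  over several silent steps would discard alternatives on the way or, if these can be revisited,
  create divergences, and the equivalence detects both. So the finite control needs one offering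
  state per possible menu, which is why the machine depends on \<open>B\<close>. A second obstacle
  is that every step of a reactive Turing machine moves the head: an offer is made in cell 0, moves
  right, and is followed by a silent step back. A third is that the machine knows \<open>M\<close>
  only as a number, so reading off the menu and updating the configuration have to be arithmetic on
  codes. Bounded iteration is enough for both, hence an expression language without unbounded
  search, in which every evaluation terminates by construction.\<close>

lemma tape_eq_iff:
  "tape_eq (l, d, r) (l', d', r') \<longleftrightarrow> d = d' \<and>
     dropWhile (\<lambda>x. x = blank) l = dropWhile (\<lambda>x. x = blank) l' \<and>
     dropWhile (\<lambda>x. x = blank) (rev r) = dropWhile (\<lambda>x. x = blank) (rev r')"
  by (auto simp: tape_eq_def)

lemma dropWhile_snoc:
  "dropWhile P (xs @ [x]) = (if P x \<and> dropWhile P xs = [] then [] else dropWhile P xs @ [x])"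
  by (induction xs) auto

text \<open>The symbol under the head after it moves to a neighbouring cell: past the end of the
  stored list the tape continues with blanks.\<close>

definition last_default :: "'a \<Rightarrow> 'a list \<Rightarrow> 'a" where
  "last_default z xs = (if xs = [] then z else last xs)"

text \<open>Trimming removes blanks at the far end of a side of the tape, whereas the head takes a
  symbol from the near end. The two meet only if the side is all blank, and then both lists supply
  \<open>z\<close>. This makes \<open>move\<close> well defined on tape instances.\<close>

lemma dropWhile_last_cong:
  assumes "dropWhile (\<lambda>x. x = z) xs = dropWhile (\<lambda>x. x = z) ys"
  shows "last_default z xs = last_default z ys \<and>
    dropWhile (\<lambda>x. x = z) (butlast xs) = dropWhile (\<lambda>x. x = z) (butlast ys)"
proof (cases xs rule: rev_cases)
  case Nil
  then have "dropWhile (\<lambda>x. x = z) ys = []"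
    using assms by simp
  then show ?thesis
    using Nil by (cases ys rule: rev_cases)
      (simp_all add: last_default_def dropWhile_snoc del: dropWhile_eq_Nil_conv split: if_splits)
next
  case (snoc xs' x)
  then show ?thesis
    using assms by (cases ys rule: rev_cases) (auto simp: last_default_def dropWhile_snoc simp del: dropWhile_eq_Nil_conv split: if_splits)
qed

fun raw_move :: "direction \<Rightarrow> 'd option \<Rightarrow> 'd raw_tape \<Rightarrow> 'd raw_tape" where
  "raw_move MoveL e (l, d, r) = (butlast l, last_default blank l, e # r)"
| "raw_move MoveR e (l, d, r) = (l @ [e], last_default blank (rev r), tl r)"

lift_definition head :: "'d tape \<Rightarrow> 'd option" is "\<lambda>(l, d, r). d"
  by (auto simp: tape_eq_iff)

lift_definition move :: "direction \<Rightarrow> 'd option \<Rightarrow> 'd tape \<Rightarrow> 'd tape" is raw_move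
proof -
  fix X and e :: "'d option" and x y :: "'d raw_tape"
  assume eq: "tape_eq x y"
  obtain l d r l' d' r' where xy: "x = (l, d, r)" "y = (l', d', r')"
    by (cases x; cases y) auto
  show "tape_eq (raw_move X e x) (raw_move X e y)"
    using eq unfolding xy
    by (cases X) (auto simp: tape_eq_iff dropWhile_snoc simp flip: butlast_rev simp del: dropWhile_eq_Nil_conv
        intro: dropWhile_last_cong[THEN conjunct1] dropWhile_last_cong[THEN conjunct2])
qed

lemma head_Tape [simp]: "head (Tape l d r) = d"
  by transfer simp

lemma move_Tape:
  "move MoveL e (Tape l d r) = left_of l (e # r)"
  "move MoveR e (Tape l d r) = right_of (l @ [e]) r"
proof -
  show "move MoveL e (Tape l d r) = left_of l (e # r)"
    by (cases "l = []") (simp_all add: left_of_def Tape.abs_eq move.abs_eq last_default_def)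
  show "move MoveR e (Tape l d r) = right_of (l @ [e]) r"
    by (cases "r = []") (simp_all add: right_of_def Tape.abs_eq move.abs_eq last_default_def last_rev)
qed

lemma Tape_exhaust: "\<exists>l d r. t = Tape l d r"
proof (transfer, goal_cases)
  case (1 t)
  then show ?case
    by (cases t) (metis tape_eq_def)
qed

lemma Tape_blank_right: "Tape l d (r @ replicate n blank) = Tape l d r"
  by transfer (simp add: tape_eq_iff dropWhile_append)

lemma Tape_blank_left: "Tape (replicate n blank @ l) d r = Tape l d r"
  by transfer (simp add: tape_eq_iff dropWhile_append)

text \<open>The defining sets of \<open>ts_of\<close> pick a representative of the tape; in terms of
  \<open>head\<close> and \<open>move\<close> none occurs.\<close>

lemma transitions_ts_of:
  "((s, x), a, y) \<in> transitions (ts_of M) \<longleftrightarrow>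
     (\<exists>e X t. (s, head x, a, e, X, t) \<in> rtrans M \<and> y = (t, move X e x))" (is "?L \<longleftrightarrow> ?R")
proof
  assume ?L
  then show ?R
    by (auto simp: ts_of_def) (metis move_Tape)+
next
  assume ?R
  then obtain e X t where *: "(s, head x, a, e, X, t) \<in> rtrans M" "y = (t, move X e x)" by blast
  obtain l d r where x: "x = Tape l d r" using Tape_exhaust by blast
  show ?L
    using * unfolding x by (cases X) (auto simp: ts_of_def move_Tape)
qed

section \<open>Deterministic silent steps and a criterion for bisimilarity\<close>

definition det :: "('s, 'l) ts \<Rightarrow> ('s \<times> 's) set" where
  "det T = {(x, y). x \<notin> finals T \<and> (\<forall>a z. (x, a, z) \<in> transitions T \<longleftrightarrow> a = tau \<and> z = y)}"

lemma det_tau: "(x, y) \<in> (det T)\<^sup>* \<Longrightarrow> (x, y) \<in> (tau_rel T)\<^sup>*"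
  by (rule subsetD[OF rtrancl_mono]) (auto simp: det_def tau_rel_def)

text \<open>An infinite silent path has no alternative to the deterministic one as long as that
  lasts, so no divergence can avoid \<open>y\<close>.\<close>

lemma det_path_reaches:
  assumes "(x, y) \<in> (det T)\<^sup>*" "f 0 = x" "\<And>i. (f i, f (Suc i)) \<in> tau_rel T"
  shows "\<exists>j. f j = y"
  using assms
proof (induction arbitrary: f rule: converse_rtrancl_induct)
  case (step x z)
  have "f 1 = z"
    using step.hyps(1) step.prems(1) step.prems(2)[of 0] by (auto simp: det_def tau_rel_def)
  then show ?case
    using step.IH[of "\<lambda>i. f (Suc i)"] step.prems by auto
qed auto

text \<open>A lock-step form of the simulation clauses: a step out of a representative is matched by
  exactly one step, and then deterministic steps lead to the next representative. Closing
  \<open>Rep\<close> backwards under \<open>det\<close> turns this into the bisimulation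
  \<open>R\<close>.\<close>

locale simulation =
  fixes T1 :: "('s, 'l) ts" and T2 :: "('t, 'l) ts" and Rep :: "('s \<times> 't) set"
  assumes Rep_states: "Rep \<subseteq> states T1 \<times> states T2"
    and trans_states: "(x, a, x') \<in> transitions T2 \<Longrightarrow> x \<in> states T2"
    and forward: "(m, y) \<in> Rep \<Longrightarrow> (m, a, m') \<in> transitions T1 \<Longrightarrow>
      \<exists>y' z. (y, a, y') \<in> transitions T2 \<and> (y', z) \<in> (det T2)\<^sup>* \<and> (m', z) \<in> Rep"
    and backward: "(m, y) \<in> Rep \<Longrightarrow> (y, a, y') \<in> transitions T2 \<Longrightarrow>
      \<exists>m' z. (m, a, m') \<in> transitions T1 \<and> (y', z) \<in> (det T2)\<^sup>* \<and> (m', z) \<in> Rep"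
    and final: "(m, y) \<in> Rep \<Longrightarrow> m \<in> finals T1 \<longleftrightarrow> y \<in> finals T2"
begin

definition R :: "('s \<times> 't) set" where
  "R = {(m, x). \<exists>y. (x, y) \<in> (det T2)\<^sup>* \<and> (m, y) \<in> Rep}"

lemma R_I: "(x, y) \<in> (det T2)\<^sup>* \<Longrightarrow> (m, y) \<in> Rep \<Longrightarrow> (m, x) \<in> R"
  unfolding R_def by blast

lemma forward_half: "dpbb_half T1 T2 R"
  unfolding dpbb_half_def
proof (intro allI impI conjI; (elim conjE)?)
  fix m x assume "(m, x) \<in> R"
  then obtain y where y: "(x, y) \<in> (det T2)\<^sup>*" "(m, y) \<in> Rep" unfolding R_def by blast
  have Ry: "(m, y) \<in> R" using y by (auto intro: R_I)
  show "\<exists>x'' x'. (x, x'') \<in> (tau_rel T2)\<^sup>* \<and> opt_step T2 x'' a x' \<and> (m, x'') \<in> R \<and> (m', x') \<in> R"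
    if "(m, a, m') \<in> transitions T1" for a m'
    using forward[OF y(2) that] det_tau[OF y(1)] Ry by (meson R_I opt_step_def)
  show "\<exists>x'. (x, x') \<in> (tau_rel T2)\<^sup>* \<and> x' \<in> finals T2 \<and> (m, x') \<in> R" if "m \<in> finals T1"
    using final[OF y(2)] that det_tau[OF y(1)] Ry by blast
  show "\<exists>x'. (x, x') \<in> (tau_rel T2)\<^sup>+ \<and> (\<exists>i. (f i, x') \<in> R)"
    if f: "f 0 = m" "\<forall>i. (f i, f (Suc i)) \<in> tau_rel T1" for f
  proof -
    \<comment> \<open>The first silent step of \<open>m\<close> is enough: its match is a real step
      from \<open>y\<close>, so the path from \<open>x\<close> is nonempty.\<close>
    have "(m, tau, f 1) \<in> transitions T1"
      using f by (metis (mono_tags, lifting) CollectD One_nat_def case_prodD tau_rel_def)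
    from forward[OF y(2) this] obtain y' z where
      z: "(y, tau, y') \<in> transitions T2" "(y', z) \<in> (det T2)\<^sup>*" "(f 1, z) \<in> Rep" by blast
    have "(y, y') \<in> tau_rel T2" using z by (simp add: tau_rel_def)
    with det_tau[OF y(1)] have "(x, y') \<in> (tau_rel T2)\<^sup>+" by (rule rtrancl_into_trancl1)
    with z show ?thesis by (blast intro: R_I)
  qed
qed

lemma backward_half: "dpbb_half T2 T1 (R\<inverse>)"
  unfolding dpbb_half_def
proof (intro allI impI conjI; (elim conjE)?)
  fix x m assume "(x, m) \<in> R\<inverse>"
  then obtain y where y: "(x, y) \<in> (det T2)\<^sup>*" "(m, y) \<in> Rep" unfolding R_def by blast
  show "\<exists>m'' m'. (m, m'') \<in> (tau_rel T1)\<^sup>* \<and> opt_step T1 m'' a m' \<and> (x, m'') \<in> R\<inverse> \<and> (x', m') \<in> R\<inverse>"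
    if x': "(x, a, x') \<in> transitions T2" for a x'
    using y(1)
  proof (cases rule: converse_rtranclE)
    \<comment> \<open>At the representative the step is a real one; before it, the step is the
      deterministic one and \<open>m\<close> stays put.\<close>
    case base
    then show ?thesis using backward[OF y(2)] x' y by (meson R_I converse_iff opt_step_def rtrancl.rtrancl_refl)
  next
    case (step z)
    then have "a = tau" "z = x'" using x' by (auto simp: det_def)
    then show ?thesis using step y by (meson R_I converse_iff opt_step_def rtrancl.rtrancl_refl)
  qed
  show "\<exists>m'. (m, m') \<in> (tau_rel T1)\<^sup>* \<and> m' \<in> finals T1 \<and> (x, m') \<in> R\<inverse>" if "x \<in> finals T2"
  proof -
    \<comment> \<open>Only \<open>y\<close> itself can be final, because \<open>det\<close> starts
      in non-final states.\<close>
    have "x = y" using y(1) that by (cases rule: converse_rtranclE) (auto simp: det_def)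
    then show ?thesis using y that final[OF y(2)] R_I by blast
  qed
  show "\<exists>m'. (m, m') \<in> (tau_rel T1)\<^sup>+ \<and> (\<exists>i. (f i, m') \<in> R\<inverse>)"
    if f: "f 0 = x" "\<forall>i. (f i, f (Suc i)) \<in> tau_rel T2" for f
  proof -
    obtain j where j: "f j = y" using det_path_reaches[of x y T2 f] y(1) f by blast
    have "(y, tau, f (Suc j)) \<in> transitions T2" using f(2) j by (auto simp: tau_rel_def)
    from backward[OF y(2) this] obtain m' z where
      "(m, tau, m') \<in> transitions T1" "(f (Suc j), z) \<in> (det T2)\<^sup>*" "(m', z) \<in> Rep" by blast
    then have "(m, m') \<in> (tau_rel T1)\<^sup>+" "(f (Suc j), m') \<in> R\<inverse>"
      by (auto simp: tau_rel_def intro: R_I)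
    then show ?thesis by blast
  qed
qed

lemma dpbb_equiv_if_start:
  assumes "(start T2, y) \<in> (det T2)\<^sup>*" "(start T1, y) \<in> Rep"
  shows "dpbb_equiv T1 T2"
proof -
  have "R \<subseteq> states T1 \<times> states T2"
  proof safe
    fix m x assume "(m, x) \<in> R"
    then obtain y where y: "(x, y) \<in> (det T2)\<^sup>*" "(m, y) \<in> Rep" unfolding R_def by blast
    show "m \<in> states T1" using y(2) Rep_states by blast
    show "x \<in> states T2"
      using y(1) by (cases rule: converse_rtranclE)
        (use y(2) Rep_states trans_states in \<open>auto simp: det_def\<close>)
  qed
  then show ?thesis
    unfolding dpbb_equiv_def dpbb_def using forward_half backward_half assms R_I by blast
qed

end

section \<open>Register machines as reactive Turing machines\<close>

definition blank_from :: "(nat \<Rightarrow> 'd option) \<Rightarrow> nat \<Rightarrow> bool" where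
  "blank_from f N \<longleftrightarrow> (\<forall>i\<ge>N. f i = blank)"

text \<open>Every cutoff beyond the last nonblank cell yields the same tape
  (\<open>tape_at_eq\<close>); the least one serves only to make the tape a function of
  \<open>f\<close> and \<open>n\<close>.\<close>

definition tape_at :: "(nat \<Rightarrow> 'd option) \<Rightarrow> nat \<Rightarrow> 'd tape" where
  "tape_at f n = Tape (map f [0..<n]) (f n) (map f [Suc n..<(LEAST N. blank_from f N)])"

lemma tape_at_eq:
  assumes "blank_from f N"
  shows "tape_at f n = Tape (map f [0..<n]) (f n) (map f [Suc n..<N])"
proof -
  define L where "L = (LEAST N. blank_from f N)"
  have L: "blank_from f L" "L \<le> N"
    unfolding L_def using assms by (auto intro: LeastI Least_le)
  have blanks: "map f [i..<j] = replicate (j - i) blank" if "L \<le> i" for i j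
    using that L(1) by (intro nth_equalityI) (auto simp: blank_from_def)
  have "\<exists>m. map f [Suc n..<N] = map f [Suc n..<L] @ replicate m blank"
  proof (cases "Suc n \<le> L")
    case True
    then have "[Suc n..<N] = [Suc n..<L] @ [L..<N]"
      using L(2) by (metis le_add_diff_inverse upt_add_eq_append)
    then show ?thesis using blanks[of L N] by auto
  next
    case False
    then show ?thesis using blanks[of "Suc n" N] by auto
  qed
  then show ?thesis
    unfolding tape_at_def L_def[symmetric] by (metis Tape_blank_right)
qed

lemma head_tape_at [simp]: "head (tape_at f n) = f n"
  by (simp add: tape_at_def)

lemma move_right_tape_at:
  assumes "blank_from f N"
  shows "move MoveR e (tape_at f n) = tape_at (f(n := e)) (Suc n)"
proof -
  define N' where "N' = N + n + 2"
  have "blank_from f N'" "blank_from (f(n := e)) N'"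
    using assms by (auto simp: blank_from_def N'_def)
  moreover have "[Suc n..<N'] = Suc n # [Suc (Suc n)..<N']"
    by (simp add: N'_def upt_rec)
  ultimately show ?thesis
    by (auto simp: tape_at_eq move_Tape right_of_def)
qed

lemma move_left_tape_at:
  assumes "blank_from f N"
  shows "move MoveL e (tape_at f (Suc n)) = tape_at (f(Suc n := e)) n"
proof -
  define N' where "N' = N + n + 2"
  have "blank_from f N'" "blank_from (f(Suc n := e)) N'"
    using assms by (auto simp: blank_from_def N'_def)
  moreover have "[Suc n..<N'] = Suc n # [Suc (Suc n)..<N']"
    by (simp add: N'_def upt_rec)
  ultimately show ?thesis
    by (auto simp: tape_at_eq move_Tape left_of_def)
qed

section \<open>Register instructions and their tape program\<close>

datatype ('q, 'l) instr = IInc nat 'q | IDec nat 'q 'q | IOffer bool "('l option \<times> 'q) list"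

fun succs :: "('q, 'l) instr \<Rightarrow> 'q set" where
  "succs (IInc r q) = {q}"
| "succs (IDec r q q') = {q, q'}"
| "succs (IOffer b xs) = snd ` set xs"

fun acts :: "('q, 'l) instr \<Rightarrow> 'l option set" where
  "acts (IOffer b xs) = fst ` set xs"
| "acts _ = {}"

fun reg :: "('q, 'l) instr \<Rightarrow> nat" where
  "reg (IInc r q) = r"
| "reg (IDec r q q') = r"
| "reg (IOffer b xs) = 0"

text \<open>\<open>Home\<close> stands on cell 0 and \<open>Back\<close> on cell 1. In
  \<open>Scan\<close>, \<open>Erase\<close> and \<open>Ret\<close> the number is the head position
  modulo \<open>k\<close>, so the control knows its track; \<open>Scan\<close> and
  \<open>Erase\<close> carry the instruction being executed, \<open>Ret\<close> the one that
  follows.\<close>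

datatype 'q phase = Init | Home 'q | Back 'q | Scan 'q nat | Erase 'q nat | Ret 'q nat

instance phase :: (countable) countable
  by countable_datatype

lemma prev_mod: "(Suc n mod k + k - 1) mod k = n mod k" if "0 < k" for k n :: nat
proof -
  have "(Suc n mod k + k - 1) mod k = (Suc n mod k + (k - 1)) mod k"
    using that by simp
  also have "\<dots> = (Suc n + (k - 1)) mod k"
    by (simp only: mod_add_left_eq)
  also have "\<dots> = n mod k"
    using that by simp
  finally show ?thesis .
qed

locale register_machine =
  fixes A :: "('a::countable, 'c::countable, 'd::countable) action set"
    and instr :: "'q::countable \<Rightarrow> ('q, ('a, 'c, 'd) action) instr"
    and Q :: "'q set" and q0 :: 'q and k :: nat and mark :: 'd
  assumes finite_Q: "finite Q" and q0: "q0 \<in> Q"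
    and succs_Q: "q \<in> Q \<Longrightarrow> succs (instr q) \<subseteq> Q"
    and acts_A: "q \<in> Q \<Longrightarrow> acts (instr q) \<subseteq> insert tau (Some ` A)"
    and reg_k: "q \<in> Q \<Longrightarrow> Suc (reg (instr q)) < k"
begin

lemma k: "1 < k"
  using reg_k[OF q0] by simp

text \<open>An increment writes at the first blank of its track. A decrement also runs to that blank
  and then turns left: the first mark met on the track is the last one of the register, and meeting
  cell 0 instead means that the register is zero, so the second target is taken.\<close>

fun delta :: "'q phase \<Rightarrow> 'd option \<Rightarrow>
    (('a, 'c, 'd) action option \<times> 'd option \<times> direction \<times> 'q phase) set" where
  "delta Init d = {(tau, Some mark, MoveR, Back q0)}"
| "delta (Home q) d = (case instr q of
      IOffer b xs \<Rightarrow> (\<lambda>(a, q'). (a, d, MoveR, Back q')) ` set xs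
    | _ \<Rightarrow> {(tau, d, MoveR, Scan q 1)})"
| "delta (Back q) d = {(tau, d, MoveL, Home q)}"
| "delta (Scan q i) d = (case instr q of
      IInc r q' \<Rightarrow> if i = Suc r \<and> d = blank then {(tau, Some mark, MoveL, Ret q' r)}
        else {(tau, d, MoveR, Scan q (Suc i mod k))}
    | IDec r q1 q2 \<Rightarrow> if i = Suc r \<and> d = blank then {(tau, d, MoveL, Erase q r)}
        else {(tau, d, MoveR, Scan q (Suc i mod k))}
    | IOffer b xs \<Rightarrow> {})"
| "delta (Erase q i) d = (case instr q of
      IDec r q1 q2 \<Rightarrow> if i = Suc r \<and> d \<noteq> blank then {(tau, blank, MoveL, Ret q1 r)}
        else if i = 0 \<and> d \<noteq> blank then {(tau, d, MoveR, Back q2)}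
        else {(tau, d, MoveL, Erase q ((i + k - 1) mod k))}
    | _ \<Rightarrow> {})"
| "delta (Ret q i) d = (if i = 0 \<and> d \<noteq> blank then {(tau, d, MoveR, Back q)}
     else {(tau, d, MoveL, Ret q ((i + k - 1) mod k))})"

definition phases :: "'q phase set" where
  "phases = {Init} \<union> Home ` Q \<union> Back ` Q \<union> case_prod Scan ` (Q \<times> {..<k}) \<union>
     case_prod Erase ` (Q \<times> {..<k}) \<union> case_prod Ret ` (Q \<times> {..<k})"

lemma phases_simps [simp]:
  "Init \<in> phases" "Home q \<in> phases \<longleftrightarrow> q \<in> Q" "Back q \<in> phases \<longleftrightarrow> q \<in> Q"
  "Scan q i \<in> phases \<longleftrightarrow> q \<in> Q \<and> i < k" "Erase q i \<in> phases \<longleftrightarrow> q \<in> Q \<and> i < k"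
  "Ret q i \<in> phases \<longleftrightarrow> q \<in> Q \<and> i < k"
  by (auto simp: phases_def)

lemma finite_phases: "finite phases"
  using finite_Q by (simp add: phases_def)

lemma delta_closed:
  assumes "p \<in> phases" "(a, e, X, p') \<in> delta p d"
  shows "p' \<in> phases" "a \<in> insert tau (Some ` A)"
proof -
  have instr: "succs (instr q) \<subseteq> Q" "acts (instr q) \<subseteq> insert tau (Some ` A)" "Suc (reg (instr q)) < k"
    if "q \<in> Q" for q
    using that succs_Q acts_A reg_k by auto
  have "p' \<in> phases \<and> a \<in> insert tau (Some ` A)"
  proof (cases p)
    case (Home q)
    then show ?thesis
      using assms k instr[of q] by (cases "instr q") (auto simp: image_subset_iff split: prod.splits; force)+
  next
    case (Scan q i)
    then show ?thesis
      using assms k instr[of q] by (cases "instr q") (auto split: if_splits)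
  next
    case (Erase q i)
    then show ?thesis
      using assms k instr[of q] by (cases "instr q") (auto split: if_splits)
  qed (use assms k q0 in \<open>auto split: if_splits\<close>)
  then show "p' \<in> phases" "a \<in> insert tau (Some ` A)" by auto
qed

definition rm :: "('a, 'c, 'd) rtm" where
  "rm = \<lparr> rstates = to_nat ` phases,
     rtrans = {(to_nat p, d, a, e, X, to_nat p') | p d a e X p'. p \<in> phases \<and> (a, e, X, p') \<in> delta p d},
     rinit = to_nat (Init :: 'q phase),
     rfinals = to_nat ` {Home q | q xs. q \<in> Q \<and> instr q = IOffer True xs} \<rparr>"

lemma is_rtm_rm: "is_rtm A rm"
proof -
  have "rtrans rm \<subseteq> rstates rm \<times> UNIV \<times> insert tau (Some ` A) \<times> UNIV \<times> UNIV \<times> rstates rm"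
    using delta_closed by (fastforce simp: rm_def)
  moreover have "rfinals rm \<subseteq> rstates rm"
    by (auto simp: rm_def)
  ultimately show ?thesis
    by (simp add: is_rtm_def rm_def finite_phases)
qed

definition conf :: "'q phase \<Rightarrow> (nat \<Rightarrow> 'd option) \<Rightarrow> nat \<Rightarrow> nat \<times> 'd tape" where
  "conf p f n = (to_nat p, tape_at f n)"

lemma transitions_rm:
  assumes "p \<in> phases"
  shows "(conf p f n, a, y) \<in> transitions (ts_of rm) \<longleftrightarrow>
    (\<exists>e X p'. (a, e, X, p') \<in> delta p (f n) \<and> y = (to_nat p', move X e (tape_at f n)))"
  using assms unfolding conf_def transitions_ts_of by (auto simp: rm_def)

lemma conf_final:
  "conf p f n \<in> finals (ts_of rm) \<longleftrightarrow> (\<exists>q xs. q \<in> Q \<and> p = Home q \<and> instr q = IOffer True xs)"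
  by (auto simp: conf_def ts_of_def rm_def)

abbreviation run :: "((nat \<times> 'd tape) \<times> (nat \<times> 'd tape)) set" where
  "run \<equiv> (det (ts_of rm))\<^sup>*"

lemma det_right:
  assumes "p \<in> phases" "delta p (f n) = {(tau, e, MoveR, p')}" "blank_from f N"
    "\<And>q xs. p = Home q \<Longrightarrow> instr q \<noteq> IOffer True xs"
  shows "(conf p f n, conf p' (f(n := e)) (Suc n)) \<in> det (ts_of rm)"
  using assms(4) unfolding det_def
  by (auto simp: transitions_rm[OF assms(1)] assms(2) conf_final move_right_tape_at[OF assms(3)])
     (auto simp: conf_def)

lemma det_left:
  assumes "p \<in> phases" "delta p (f (Suc n)) = {(tau, e, MoveL, p')}" "blank_from f N"
    "\<And>q. p \<noteq> Home q"
  shows "(conf p f (Suc n), conf p' (f(Suc n := e)) n) \<in> det (ts_of rm)"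
  using assms(4) unfolding det_def
  by (auto simp: transitions_rm[OF assms(1)] assms(2) conf_final move_left_tape_at[OF assms(3)])
     (auto simp: conf_def)

text \<open>
  The tape is split into \<open>k\<close> interleaved tracks. Track 0 only carries the mark in cell 0, by which the
  head finds its way back; track \<open>Suc r\<close> holds register \<open>r\<close> in unary.
\<close>
definition cells :: "(nat \<Rightarrow> nat) \<Rightarrow> nat \<Rightarrow> 'd option" where
  "cells s n = (if n = 0 \<or> n mod k \<noteq> 0 \<and> n div k < s (n mod k - 1) then Some mark else blank)"

text \<open>Even if \<open>s\<close> has infinitely many nonzero values, only finitely many
  registers own a track, so their maximum bounds the marked part.\<close>

lemma cells_blank_from: "\<exists>N. blank_from (cells s) N"
proof
  define m where "m = Max (s ` {..<k})"
  show "blank_from (cells s) (Suc m * k)"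
    unfolding blank_from_def
  proof (intro allI impI)
    fix n assume n: "Suc m * k \<le> n"
    have "s (n mod k - 1) \<le> m"
      unfolding m_def using k
      by (intro Max_ge) (auto intro!: imageI simp: less_imp_diff_less)
    moreover have "Suc m \<le> n div k"
      using n k by (metis div_le_mono div_mult_self_is_m less_trans zero_less_one)
    moreover have "n \<noteq> 0" using n k by auto
    ultimately show "cells s n = blank" by (auto simp: cells_def)
  qed
qed

abbreviation home :: "'q \<Rightarrow> (nat \<Rightarrow> nat) \<Rightarrow> nat \<times> 'd tape" where
  "home q s \<equiv> conf (Home q) (cells s) 0"

section \<open>Single instructions executed on the tape\<close>

lemma right_step:
  assumes "p \<in> phases" "delta p (cells s n) = {(tau, cells s n, MoveR, p')}"
    "\<And>q xs. p = Home q \<Longrightarrow> instr q \<noteq> IOffer True xs"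
  shows "(conf p (cells s) n, conf p' (cells s) (Suc n)) \<in> det (ts_of rm)"
  using det_right[of p "cells s" n "cells s n" p'] assms cells_blank_from[of s] by auto

lemma left_step:
  assumes "p \<in> phases" "delta p (cells s (Suc n)) = {(tau, cells s (Suc n), MoveL, p')}"
    "\<And>q. p \<noteq> Home q"
  shows "(conf p (cells s) (Suc n), conf p' (cells s) n) \<in> det (ts_of rm)"
  using det_left[of p "cells s" n "cells s (Suc n)" p'] assms cells_blank_from[of s] by auto

lemma run_Back: "q \<in> Q \<Longrightarrow> (conf (Back q) (cells s) 1, home q s) \<in> run"
  using left_step[of "Back q" s 0] by auto

lemma cells_simps:
  "cells s 0 = Some mark" "0 < n \<Longrightarrow> n mod k = 0 \<Longrightarrow> cells s n = blank"
  "n mod k = Suc r \<Longrightarrow> cells s n = (if n div k < s r then Some mark else blank)"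
  by (auto simp: cells_def)

text \<open>The walk ends at residue 0 with a nonblank symbol. Register marks have other residues,
  and track 0 is blank except in cell 0, so it cannot end too early.\<close>

lemma run_Ret:
  assumes "q \<in> Q"
  shows "(conf (Ret q (n mod k)) (cells s) n, home q s) \<in> run"
proof (induction n)
  case 0
  have "(conf (Ret q 0) (cells s) 0, conf (Back q) (cells s) (Suc 0)) \<in> det (ts_of rm)"
    using assms k by (intro right_step) (auto simp: cells_simps)
  then show ?case
    using run_Back[OF assms, of s] by auto
next
  case (Suc n)
  have "(conf (Ret q (Suc n mod k)) (cells s) (Suc n), conf (Ret q (n mod k)) (cells s) n) \<in> det (ts_of rm)"
    using assms k prev_mod[of k n] cells_simps(2)[of "Suc n" s]
    by (intro left_step; cases "Suc n mod k = 0") auto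
  with Suc show ?case by (rule converse_rtrancl_into_rtrancl[rotated])
qed

text \<open>Cell number \<open>j\<close> of the track of register \<open>r\<close>, counted from 0;
  the first blank of the track is therefore number \<open>s r\<close>.\<close>

definition cell_of :: "nat \<Rightarrow> nat \<Rightarrow> nat" where
  "cell_of r j = j * k + Suc r"

lemma cell_of: "Suc r < k \<Longrightarrow> cell_of r j mod k = Suc r" "Suc r < k \<Longrightarrow> cell_of r j div k = j"
  "cell_of r j = Suc (j * k + r)" "Suc r < k \<Longrightarrow> (j * k + r) mod k = r"
proof -
  show "cell_of r j div k = j" if "Suc r < k"
    using that div_mult_self1[of k "Suc r" j] by (simp add: cell_of_def ac_simps)
qed (auto simp: cell_of_def mod_Suc_eq[of "j * k + r" for j r, symmetric])

lemma eq_cell_of: "n mod k = Suc r \<Longrightarrow> n = cell_of r (n div k)"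
  unfolding cell_of_def by (metis div_mult_mod_eq)

lemma cell_of_less_iff: "cell_of r i < cell_of r j \<longleftrightarrow> i < j"
  using k by (simp add: cell_of_def)

lemma cells_upd:
  assumes "Suc r < k"
  shows "(cells s)(cell_of r (s r) := Some mark) = cells (s(r := Suc (s r)))"
    "s r = Suc j \<Longrightarrow> (cells s)(cell_of r j := blank) = cells (s(r := j))"
proof -
  have inj: "n = cell_of r j \<longleftrightarrow> n mod k = Suc r \<and> n div k = j" for n j
    using cell_of(1,2)[OF assms] eq_cell_of by auto
  have other: "cells (s(r := x)) n = cells s n" if "n mod k \<noteq> Suc r" for n x
    using that by (auto simp: cells_def)
  show "(cells s)(cell_of r (s r) := Some mark) = cells (s(r := Suc (s r)))"
  proof
    fix n
    show "((cells s)(cell_of r (s r) := Some mark)) n = cells (s(r := Suc (s r))) n"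
      by (cases "n mod k = Suc r") (auto simp: inj other cells_simps(3))
  qed
  show "(cells s)(cell_of r j := blank) = cells (s(r := j))" if "s r = Suc j"
  proof
    fix n
    show "((cells s)(cell_of r j := blank)) n = cells (s(r := j)) n"
      using that by (cases "n mod k = Suc r") (auto simp: inj other cells_simps(3))
  qed
qed

lemma run_Scan:
  assumes "q \<in> Q" "instr q = IInc r q' \<or> instr q = IDec r q1 q2"
  shows "(home q s, conf (Scan q (Suc r)) (cells s) (cell_of r (s r))) \<in> run"
proof -
  have r: "Suc r < k" using reg_k[OF assms(1)] assms(2) by auto
  \<comment> \<open>Up to cell number \<open>s r\<close> every cell of the track is marked, so the
    scan passes over it.\<close>
  have step: "(conf (Scan q (n mod k)) (cells s) n, conf (Scan q (Suc n mod k)) (cells s) (Suc n)) \<in> det (ts_of rm)"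
    if "n < cell_of r (s r)" for n
  proof (rule right_step)
    have "\<not> (n mod k = Suc r \<and> cells s n = blank)"
      using that eq_cell_of[of n r] cell_of_less_iff[of r "n div k" "s r"] by (auto simp: cells_simps)
    then show "delta (Scan q (n mod k)) (cells s n) = {(tau, cells s n, MoveR, Scan q (Suc n mod k))}"
      using assms(2) by (auto simp: mod_Suc_eq)
  qed (use assms k in auto)
  have "(conf (Scan q (n mod k)) (cells s) n,
      conf (Scan q (cell_of r (s r) mod k)) (cells s) (cell_of r (s r))) \<in> run" if "n \<le> cell_of r (s r)" for n
    using that
    by (induction rule: inc_induct) (auto intro: converse_rtrancl_into_rtrancl step)
  from this[of 1] have "(conf (Scan q 1) (cells s) 1, conf (Scan q (Suc r)) (cells s) (cell_of r (s r))) \<in> run"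
    using k r by (simp add: cell_of)
  moreover have "(home q s, conf (Scan q 1) (cells s) (Suc 0)) \<in> det (ts_of rm)"
    using assms by (intro right_step) auto
  ultimately show ?thesis by (metis One_nat_def converse_rtrancl_into_rtrancl)
qed

lemma run_inc:
  assumes "q \<in> Q" "instr q = IInc r q'"
  shows "(home q s, home q' (s(r := Suc (s r)))) \<in> run"
proof -
  have r: "Suc r < k" using reg_k[OF assms(1)] assms(2) by auto
  have q': "q' \<in> Q" using succs_Q[OF assms(1)] assms(2) by auto
  obtain N where N: "blank_from (cells s) N" using cells_blank_from by blast
  have "(conf (Scan q (Suc r)) (cells s) (cell_of r (s r)),
      conf (Ret q' r) (cells (s(r := Suc (s r)))) (s r * k + r)) \<in> det (ts_of rm)"
    unfolding cells_upd(1)[OF r, symmetric] unfolding cell_of(3)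
    using r assms by (intro det_left[OF _ _ N])
      (auto simp: cells_simps(3) cell_of(1,2)[OF r] simp flip: cell_of(3))
  moreover have "(conf (Ret q' r) (cells (s(r := Suc (s r)))) (s r * k + r), home q' (s(r := Suc (s r)))) \<in> run"
    using run_Ret[OF q', of "s r * k + r"] cell_of(4)[OF r] by simp
  ultimately show ?thesis
    using run_Scan[OF assms(1)] assms(2)
    by (meson converse_rtrancl_into_rtrancl rtrancl_trans)
qed

lemma run_Erase:
  assumes "q \<in> Q" "instr q = IDec r q1 q2" "m \<le> n"
    "\<And>j. m < j \<Longrightarrow> j \<le> n \<Longrightarrow> j mod k = Suc r \<Longrightarrow> cells s j = blank"
  shows "(conf (Erase q (n mod k)) (cells s) n, conf (Erase q (m mod k)) (cells s) m) \<in> run"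
  using assms(3,4)
proof (induction rule: dec_induct)
  case (step n)
  have "(conf (Erase q (Suc n mod k)) (cells s) (Suc n), conf (Erase q (n mod k)) (cells s) n) \<in> det (ts_of rm)"
  proof (rule left_step)
    show "delta (Erase q (Suc n mod k)) (cells s (Suc n)) =
        {(tau, cells s (Suc n), MoveL, Erase q (n mod k))}"
      using assms(2) step.prems[of "Suc n"] step.hyps k prev_mod[of k n] cells_simps(2)[of "Suc n" s]
      by (cases "Suc n mod k = 0") auto
  qed (use assms k in auto)
  with step show ?case by (auto intro: converse_rtrancl_into_rtrancl)
qed simp

lemma run_Scan_Erase:
  assumes "q \<in> Q" "instr q = IDec r q1 q2"
  shows "(home q s, conf (Erase q r) (cells s) (s r * k + r)) \<in> run"
proof -
  have r: "Suc r < k" using reg_k[OF assms(1)] assms(2) by auto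
  have "(conf (Scan q (Suc r)) (cells s) (cell_of r (s r)), conf (Erase q r) (cells s) (s r * k + r)) \<in> det (ts_of rm)"
    unfolding cell_of(3) using r assms by (intro left_step)
      (auto simp: cells_simps(3) cell_of(1,2)[OF r] simp flip: cell_of(3))
  then show ?thesis
    using run_Scan[OF assms(1)] assms(2) by (meson rtrancl.rtrancl_into_rtrancl)
qed

lemma run_dec_zero:
  assumes "q \<in> Q" "instr q = IDec r q1 q2" "s r = 0"
  shows "(home q s, home q2 s) \<in> run"
proof -
  have r: "Suc r < k" using reg_k[OF assms(1)] assms(2) by auto
  have q2: "q2 \<in> Q" using succs_Q[OF assms(1)] assms(2) by auto
  have "(home q s, conf (Erase q r) (cells s) r) \<in> run"
    using run_Scan_Erase[OF assms(1,2), of s] assms(3) by simp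
  \<comment> \<open>The scan turned at cell \<open>Suc r\<close>; cells 1 to \<open>r\<close> lie on
    lower tracks, so nothing is erased on the way to cell 0.\<close>
  also have "(conf (Erase q r) (cells s) r, conf (Erase q 0) (cells s) 0) \<in> run"
    using run_Erase[OF assms(1,2), of 0 r s] r by auto
  also have "(conf (Erase q 0) (cells s) 0, conf (Back q2) (cells s) (Suc 0)) \<in> run"
    using assms k by (intro r_into_rtrancl right_step) (auto simp: cells_simps)
  also have "(conf (Back q2) (cells s) (Suc 0), home q2 s) \<in> run"
    using run_Back[OF q2, of s] by simp
  finally show ?thesis .
qed

lemma run_dec_Suc:
  assumes "q \<in> Q" "instr q = IDec r q1 q2" "s r = Suc j"
  shows "(home q s, home q1 (s(r := j))) \<in> run"
proof -
  have r: "Suc r < k" using reg_k[OF assms(1)] assms(2) by auto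
  have q1: "q1 \<in> Q" using succs_Q[OF assms(1)] assms(2) by auto
  obtain N where N: "blank_from (cells s) N" using cells_blank_from by blast
  have le: "cell_of r j \<le> s r * k + r"
    using assms(3) k by (simp add: cell_of_def)
  \<comment> \<open>The turning point is just left of the blank that ended the scan, so the next
    marked cell of the track is number \<open>j\<close>, the last one of the register.\<close>
  have blanks: "cells s i = blank" if "cell_of r j < i" "i \<le> s r * k + r" "i mod k = Suc r" for i
  proof -
    have "i = cell_of r (i div k)" using that eq_cell_of by blast
    then have "cell_of r j < cell_of r (i div k)" using that(1) by linarith
    then show ?thesis
      using that assms(3) by (simp add: cells_simps(3) cell_of_less_iff)
  qed
  have "(home q s, conf (Erase q r) (cells s) (s r * k + r)) \<in> run"
    by (rule run_Scan_Erase[OF assms(1,2)])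
  also have "(conf (Erase q r) (cells s) (s r * k + r), conf (Erase q (Suc r)) (cells s) (cell_of r j)) \<in> run"
    using run_Erase[of q r q1 q2 "cell_of r j" "s r * k + r" s] assms(1,2) le blanks cell_of(1,4)[OF r]
    by simp
  also have "(conf (Erase q (Suc r)) (cells s) (cell_of r j), conf (Ret q1 r) (cells (s(r := j))) (j * k + r)) \<in> run"
    unfolding cells_upd(2)[of r s j, OF r assms(3), symmetric] unfolding cell_of(3)
    using r assms by (intro r_into_rtrancl det_left[OF _ _ N])
      (auto simp: cells_simps(3) cell_of(1,2)[OF r] simp flip: cell_of(3))
  also have "(conf (Ret q1 r) (cells (s(r := j))) (j * k + r), home q1 (s(r := j))) \<in> run"
    using run_Ret[OF q1, of "j * k + r"] cell_of(4)[OF r] by simp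
  finally show ?thesis .
qed

lemma transitions_offer:
  assumes "q \<in> Q" "instr q = IOffer b xs"
  shows "(home q s, a, y) \<in> transitions (ts_of rm) \<longleftrightarrow>
    (\<exists>q'. (a, q') \<in> set xs \<and> y = conf (Back q') (cells s) 1)"
proof -
  obtain N where "blank_from (cells s) N" using cells_blank_from by blast
  from move_right_tape_at[OF this, of "cells s 0" 0] show ?thesis
    using assms by (subst transitions_rm) (auto simp: conf_def, metis (no_types, lifting) image_eqI old.prod.case)
qed

lemma run_nop:
  assumes "q \<in> Q" "instr q = IOffer False [(tau, q')]"
  shows "(home q s, home q' s) \<in> run"
proof -
  have "q' \<in> Q" using succs_Q[OF assms(1)] assms(2) by auto
  moreover have "(home q s, conf (Back q') (cells s) (Suc 0)) \<in> det (ts_of rm)"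
    using assms by (intro right_step) auto
  ultimately show ?thesis
    using run_Back[of q' s] by auto
qed

lemma run_start: "(start (ts_of rm), home q0 (\<lambda>_. 0)) \<in> run"
proof -
  have blank: "blank_from (\<lambda>_. blank) 0" by (simp add: blank_from_def)
  have "start (ts_of rm) = conf Init (\<lambda>_. blank) 0"
    using tape_at_eq[OF blank, of 0, symmetric] by (simp add: ts_of_def rm_def conf_def)
  moreover have "cells (\<lambda>_. 0) = (\<lambda>_. blank)(0 := Some mark)"
    by (auto simp: cells_def)
  then have "(conf Init (\<lambda>_. blank) 0, conf (Back q0) (cells (\<lambda>_. 0)) (Suc 0)) \<in> det (ts_of rm)"
    using det_right[where p = Init and f = "\<lambda>_. blank" and n = 0 and e = "Some mark" and p' = "Back q0", OF _ _ blank] by simp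
  ultimately show ?thesis
    using run_Back[OF q0, of "\<lambda>_. 0"] by auto
qed

lemma home_final: "q \<in> Q \<Longrightarrow> home q s \<in> finals (ts_of rm) \<longleftrightarrow> (\<exists>xs. instr q = IOffer True xs)"
  by (auto simp: conf_final)

lemma home_states: "q \<in> Q \<Longrightarrow> home q s \<in> states (ts_of rm)"
  by (auto simp: conf_def ts_of_def rm_def)

end

section \<open>Structured programs on registers\<close>

datatype 'l com = Skip | Inc nat | Seq "'l com" "'l com" (infixr ";;" 60) | While nat "'l com"
  | IfDec nat "'l com" "'l com" | Offer bool nat "'l option list"

instance com :: (countable) countable
  by countable_datatype

text \<open>
  A control state is the stack of commands that are still to be executed. \<open>While\<close> and \<open>IfDec\<close> decrement the
  tested register when it is nonzero, and \<open>Offer\<close> adds the index of the chosen action to its register.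
\<close>
fun instr_of :: "'l com list \<Rightarrow> ('l com list, 'l) instr" where
  "instr_of [] = IOffer False []"
| "instr_of (Skip # ks) = IOffer False [(tau, ks)]"
| "instr_of (Inc r # ks) = IInc r ks"
| "instr_of ((a ;; b) # ks) = IOffer False [(tau, a # b # ks)]"
| "instr_of (While r c # ks) = IDec r (c # While r c # ks) ks"
| "instr_of (IfDec r a b # ks) = IDec r (a # ks) (b # ks)"
| "instr_of (Offer fin r as # ks) =
     IOffer fin (map (\<lambda>i. (as ! i, replicate i (Inc r) @ ks)) [0..<length as])"

text \<open>Until \<open>ks\<close> is exposed, executing \<open>c\<close> on top of
  \<open>ks\<close> stays within these stacks. A loop puts back the same \<open>While\<close>, so
  stacks do not grow and the control is finite. For \<open>Offer\<close> the set includes the states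
  that count out the chosen index.\<close>

fun conts :: "'l com \<Rightarrow> 'l com list \<Rightarrow> 'l com list set" where
  "conts Skip ks = {Skip # ks}"
| "conts (Inc r) ks = {Inc r # ks}"
| "conts (a ;; b) ks = insert ((a ;; b) # ks) (conts a (b # ks) \<union> conts b ks)"
| "conts (While r c) ks = insert (While r c # ks) (conts c (While r c # ks))"
| "conts (IfDec r a b) ks = insert (IfDec r a b # ks) (conts a ks \<union> conts b ks)"
| "conts (Offer fin r as) ks = insert (Offer fin r as # ks)
     ((\<lambda>i. replicate (Suc i) (Inc r) @ ks) ` {..<length as})"

lemma finite_conts: "finite (conts c ks)"
  by (induction c arbitrary: ks) auto

lemma conts_start: "c # ks \<in> conts c ks"
  by (cases c) auto

lemma conts_closed: "q \<in> conts c ks \<Longrightarrow> succs (instr_of q) \<subseteq> insert ks (conts c ks)"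
proof (induction c arbitrary: ks)
  case (Offer fin r as)
  \<comment> \<open>Index 0 leaves no increments, so the successor is \<open>ks\<close> itself;
    other indices are shifted by one.\<close>
  have "replicate i (Inc r) @ ks \<in> insert ks (conts (Offer fin r as) ks)" if "i < length as" for i
    using that by (cases i) (auto intro!: image_eqI[of _ _ "i - 1"])
  moreover have "q = Offer fin r as # ks \<or> (\<exists>i < length as. q = replicate (Suc i) (Inc r) @ ks)"
    using Offer by auto
  ultimately show ?case
    by (elim disjE exE conjE) (simp_all del: conts.simps add: image_subset_iff)
qed (use conts_start in \<open>auto, blast+\<close>)

fun com_acts :: "'l com \<Rightarrow> 'l option set" where
  "com_acts (a ;; b) = com_acts a \<union> com_acts b"
| "com_acts (While r c) = com_acts c"
| "com_acts (IfDec r a b) = com_acts a \<union> com_acts b"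
| "com_acts (Offer fin r as) = set as"
| "com_acts _ = {}"

lemma conts_acts: "q \<in> conts c ks \<Longrightarrow> acts (instr_of q) \<subseteq> insert tau (com_acts c)"
  by (induction c arbitrary: ks) (fastforce simp: set_conv_nth)+

text \<open>A non-final offer of the silent label alone counts as a step: it is deterministic on the
  tape and realises \<open>Skip\<close> and \<open>;;\<close>.\<close>

definition cstep :: "(('l com list \<times> (nat \<Rightarrow> nat)) \<times> ('l com list \<times> (nat \<Rightarrow> nat))) set" where
  "cstep = {((q, s), (q', s')).
     (\<exists>r. instr_of q = IInc r q' \<and> s' = s(r := Suc (s r))) \<or>
     (\<exists>r q2 j. instr_of q = IDec r q' q2 \<and> s r = Suc j \<and> s' = s(r := j)) \<or>
     (\<exists>r q1. instr_of q = IDec r q1 q' \<and> s r = 0 \<and> s' = s) \<or>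
     instr_of q = IOffer False [(tau, q')] \<and> s' = s}"

text \<open>Quantifying over the rest \<open>ks\<close> of the stack makes executions independent of
  their context, so that they compose.\<close>

definition exec :: "'l com \<Rightarrow> (nat \<Rightarrow> nat) \<Rightarrow> (nat \<Rightarrow> nat) \<Rightarrow> bool" where
  "exec c s t \<longleftrightarrow> (\<forall>ks. ((c # ks, s), (ks, t)) \<in> cstep\<^sup>*)"

lemma exec_Skip: "exec Skip s s"
  by (auto simp: exec_def cstep_def)

lemma exec_Inc: "exec (Inc r) s (s(r := Suc (s r)))"
  by (auto simp: exec_def cstep_def)

lemma exec_Seq: "exec a s t \<Longrightarrow> exec b t u \<Longrightarrow> exec (a ;; b) s u"
  unfolding exec_def
  by (intro allI converse_rtrancl_into_rtrancl[of "((a ;; b) # ks, s)" "(a # b # ks, s)" for ks])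
     (auto simp: cstep_def intro: rtrancl_trans)

lemma exec_While_zero: "s r = 0 \<Longrightarrow> exec (While r c) s s"
  by (auto simp: exec_def cstep_def)

lemma exec_While_Suc:
  "s r = Suc j \<Longrightarrow> exec c (s(r := j)) t \<Longrightarrow> exec (While r c) t u \<Longrightarrow> exec (While r c) s u"
  unfolding exec_def
  by (intro allI converse_rtrancl_into_rtrancl[of "(While r c # ks, s)" "(c # While r c # ks, s(r := j))" for ks])
     (auto simp: cstep_def intro: rtrancl_trans)

lemma exec_IfDec_zero: "s r = 0 \<Longrightarrow> exec b s t \<Longrightarrow> exec (IfDec r a b) s t"
  unfolding exec_def
  by (intro allI converse_rtrancl_into_rtrancl[of "(IfDec r a b # ks, s)" "(b # ks, s)" for ks])
     (auto simp: cstep_def)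

lemma exec_IfDec_Suc: "s r = Suc j \<Longrightarrow> exec a (s(r := j)) t \<Longrightarrow> exec (IfDec r a b) s t"
  unfolding exec_def
  by (intro allI converse_rtrancl_into_rtrancl[of "(IfDec r a b # ks, s)" "(a # ks, s(r := j))" for ks])
     (auto simp: cstep_def)

lemma exec_eq: "exec c s t \<Longrightarrow> t = t' \<Longrightarrow> exec c s t'"
  by simp

abbreviation clear :: "nat \<Rightarrow> 'l com" where "clear r \<equiv> While r Skip"

lemma exec_clear: "exec (clear r :: 'l com) s (s(r := 0))"
proof (induction "s r" arbitrary: s)
  case 0
  then show ?case by (intro exec_eq[OF exec_While_zero]) auto
next
  case (Suc j)
  from Suc(1)[of "s(r := j)"] have "exec (clear r :: 'l com) (s(r := j)) (s(r := 0))" by simp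
  with Suc(2) show ?case by (metis exec_While_Suc exec_Skip)
qed

definition transfer :: "nat \<Rightarrow> nat \<Rightarrow> 'l com" where "transfer r t = While r (Inc t)"

lemma exec_transfer: "r \<noteq> t \<Longrightarrow> exec (transfer r t :: 'l com) s (s(r := 0, t := s t + s r))"
  unfolding transfer_def
proof (induction "s r" arbitrary: s)
  case 0
  then show ?case by (intro exec_eq[OF exec_While_zero]) auto
next
  case (Suc j)
  let ?s = "s(r := j, t := Suc (s t))"
  have "exec (Inc t :: 'l com) (s(r := j)) ?s"
    using Suc.prems by (intro exec_eq[OF exec_Inc]) auto
  moreover have "exec (While r (Inc t) :: 'l com) ?s (s(r := 0, t := s t + s r))"
    using Suc.prems Suc.hyps by (intro exec_eq[OF Suc.hyps(1)]) (auto simp: fun_eq_iff)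
  ultimately show ?case
    using Suc.hyps(2) by (metis exec_While_Suc)
qed

text \<open>A register can only be read by counting it down. The loop therefore makes two copies,
  the second of which restores \<open>r\<close>.\<close>

definition copy :: "nat \<Rightarrow> nat \<Rightarrow> 'l com" where
  "copy r t = While r (Inc t ;; Inc (Suc t)) ;; transfer (Suc t) r"

lemma exec_copy:
  assumes "r < t" "s t = 0" "s (Suc t) = 0"
  shows "exec (copy r t :: 'l com) s (s(t := s r))"
proof -
  have loop: "exec (While r (Inc t ;; Inc (Suc t)) :: 'l com) s (s(r := 0, t := s t + s r, Suc t := s (Suc t) + s r))" for s
  proof (induction "s r" arbitrary: s)
    case 0
    then show ?case by (intro exec_eq[OF exec_While_zero]) auto
  next
    case (Suc j)
    let ?s = "s(r := j, t := Suc (s t), Suc t := Suc (s (Suc t)))"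
    have "exec (Inc t ;; Inc (Suc t) :: 'l com) (s(r := j)) ?s"
      using assms(1) by (intro exec_eq[OF exec_Seq[OF exec_Inc exec_Inc]]) auto
    moreover have "exec (While r (Inc t ;; Inc (Suc t)) :: 'l com) ?s
        (s(r := 0, t := s t + s r, Suc t := s (Suc t) + s r))"
      using assms(1) Suc.hyps by (intro exec_eq[OF Suc.hyps(1)]) (auto simp: fun_eq_iff)
    ultimately show ?case
      using Suc.hyps(2) by (metis exec_While_Suc)
  qed
  show ?thesis
    unfolding copy_def using assms
    by (intro exec_eq[OF exec_Seq[OF loop exec_transfer]]) (auto simp: fun_eq_iff)
qed

section \<open>Expressions with bounded iteration and their compilation\<close>

datatype exp = EZero | EVar nat | ESuc exp | EPred exp | EIter nat nat exp exp exp
  | EApp exp exp exp exp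

text \<open>The index descends because a \<open>While\<close> register is its own counter. A loop
  that conses its indices thus builds an ascending list.\<close>

primrec loop :: "(nat \<Rightarrow> 'b \<Rightarrow> 'b) \<Rightarrow> nat \<Rightarrow> 'b \<Rightarrow> 'b" where
  "loop f 0 a = a"
| "loop f (Suc i) a = loop f i (f i a)"

definition args :: "'b \<Rightarrow> 'b \<Rightarrow> 'b \<Rightarrow> 'b \<Rightarrow> nat \<Rightarrow> 'b" where
  "args z a b c = (\<lambda>_. z)(0 := a, 1 := b, 2 := c)"

lemma args_simps [simp]:
  "args z a b c 0 = a" "args z a b c 1 = b" "args z a b c (Suc 0) = b" "args z a b c 2 = c"
  by (auto simp: args_def)

text \<open>
  In \<open>EIter x y n e0 e1\<close>, the variable \<open>x\<close> counts down to 0 and \<open>y\<close> is the accumulator;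
  \<open>EApp a b c e\<close> evaluates \<open>e\<close> with \<open>a\<close>, \<open>b\<close>, \<open>c\<close> as its only variables, so that no renaming is needed
  when functions are composed.
\<close>
primrec eval :: "(nat \<Rightarrow> nat) \<Rightarrow> exp \<Rightarrow> nat" where
  "eval \<sigma> EZero = 0"
| "eval \<sigma> (EVar i) = \<sigma> i"
| "eval \<sigma> (ESuc e) = Suc (eval \<sigma> e)"
| "eval \<sigma> (EPred e) = eval \<sigma> e - 1"
| "eval \<sigma> (EIter x y n e0 e1) =
     loop (\<lambda>i a. eval (\<sigma>(x := i, y := a)) e1) (eval \<sigma> n) (eval \<sigma> e0)"
| "eval \<sigma> (EApp a b c e) = eval (args 0 (eval \<sigma> a) (eval \<sigma> b) (eval \<sigma> c)) e"

text \<open>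
  \<open>compile \<rho> b e\<close> leaves the value of \<open>e\<close> in register \<open>b\<close>, where variable \<open>i\<close> is stored in register \<open>\<rho> i\<close>
  and the registers from \<open>b\<close> on are free; register 0 always holds 0.
\<close>
primrec compile :: "(nat \<Rightarrow> nat) \<Rightarrow> nat \<Rightarrow> exp \<Rightarrow> 'l com" where
  "compile \<rho> b EZero = Skip"
| "compile \<rho> b (EVar i) = copy (\<rho> i) b"
| "compile \<rho> b (ESuc e) = compile \<rho> b e ;; Inc b"
| "compile \<rho> b (EPred e) = compile \<rho> b e ;; IfDec b Skip Skip"
| "compile \<rho> b (EIter x y n e0 e1) = compile \<rho> b n ;; compile \<rho> (b + 1) e0 ;;
     While b (compile (\<rho>(x := b, y := b + 1)) (b + 2) e1 ;; clear (b + 1) ;; transfer (b + 2) (b + 1)) ;;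
     transfer (b + 1) b"
| "compile \<rho> b (EApp a1 a2 a3 e) = compile \<rho> b a1 ;; compile \<rho> (b + 1) a2 ;; compile \<rho> (b + 2) a3 ;;
     compile (args 0 b (b + 1) (b + 2)) (b + 3) e ;; clear b ;; clear (b + 1) ;; clear (b + 2) ;;
     transfer (b + 3) b"

lemma exec_compile:
  assumes "\<And>i. \<rho> i < b" "\<And>j. b \<le> j \<Longrightarrow> s j = 0" "s 0 = 0"
  shows "exec (compile \<rho> b e :: 'l com) s (s(b := eval (s \<circ> \<rho>) e))"
  using assms
proof (induction e arbitrary: \<rho> b s)
  case EZero
  then show ?case by (simp add: exec_Skip fun_upd_idem)
next
  case (EVar i)
  then have "exec (copy (\<rho> i) b :: 'l com) s (s(b := s (\<rho> i)))"
    by (intro exec_copy) auto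
  then show ?case by (simp only: compile.simps eval.simps o_apply)
next
  case (ESuc e)
  have "exec (compile \<rho> b e :: 'l com) s (s(b := eval (s \<circ> \<rho>) e))"
    by (rule ESuc.IH) (use ESuc.prems in auto)
  moreover have "exec (Inc b :: 'l com) (s(b := eval (s \<circ> \<rho>) e)) (s(b := Suc (eval (s \<circ> \<rho>) e)))"
    by (intro exec_eq[OF exec_Inc]) (simp only: fun_upd_same fun_upd_upd)
  ultimately show ?case
    by (simp only: compile.simps eval.simps exec_Seq)
next
  case (EPred e)
  let ?s = "s(b := eval (s \<circ> \<rho>) e)"
  have "exec (IfDec b Skip Skip :: 'l com) ?s (s(b := eval (s \<circ> \<rho>) e - 1))"
    by (cases "eval (s \<circ> \<rho>) e")
       (auto intro: exec_IfDec_zero[OF _ exec_eq[OF exec_Skip]] exec_IfDec_Suc[OF _ exec_eq[OF exec_Skip]])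
  moreover have "exec (compile \<rho> b e :: 'l com) s ?s"
    by (rule EPred.IH) (use EPred.prems in auto)
  ultimately show ?case
    by (simp only: compile.simps eval.simps exec_Seq)
next
  case (EIter x y n e0 e1)
  have ne: "\<rho> i \<noteq> b" "\<rho> i \<noteq> Suc b" for i
    using EIter.prems(1)[of i] by auto
  have env: "s(b := v) \<circ> \<rho> = s \<circ> \<rho>" "s(b := v, Suc b := v') \<circ> \<rho> = s \<circ> \<rho>" for v v'
    using ne by (auto simp: fun_eq_iff)
  have b: "0 < b" "\<rho> i < Suc b" for i
    using EIter.prems(1)[of i] by auto
  define f where "f = (\<lambda>i a. eval ((s \<circ> \<rho>)(x := i, y := a)) e1)"
  define body where "body = (compile (\<rho>(x := b, y := b + 1)) (b + 2) e1 ;; clear (b + 1) ;; transfer (b + 2) (b + 1) :: 'l com)"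
  have 1: "exec (compile \<rho> b n :: 'l com) s (s(b := eval (s \<circ> \<rho>) n))"
    by (rule EIter.IH(1)) (use EIter.prems in auto)
  have 2: "exec (compile \<rho> (b + 1) e0 :: 'l com) (s(b := v)) (s(b := v, Suc b := eval (s \<circ> \<rho>) e0))" for v
  proof -
    have "exec (compile \<rho> (b + 1) e0 :: 'l com) (s(b := v)) (s(b := v, b + 1 := eval (s(b := v) \<circ> \<rho>) e0))"
      by (rule EIter.IH(2)) (use b EIter.prems in auto)
    then show ?thesis unfolding env by (simp only: Suc_eq_plus1)
  qed
  \<comment> \<open>The new accumulator is computed in \<open>b + 2\<close> while the old one is
    still readable in \<open>b + 1\<close>, and replaces it only then.\<close>
  have step: "exec body (s(b := i, Suc b := a)) (s(b := i, Suc b := f i a))" for i a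
  proof -
    let ?s = "s(b := i, Suc b := a)"
    have "?s \<circ> \<rho>(x := b, y := b + 1) = (s \<circ> \<rho>)(x := i, y := a)"
      using ne by (auto simp: fun_eq_iff)
    moreover have "exec (compile (\<rho>(x := b, y := b + 1)) (b + 2) e1 :: 'l com) ?s
        (?s(b + 2 := eval (?s \<circ> \<rho>(x := b, y := b + 1)) e1))"
      by (rule EIter.IH(3)) (use b EIter.prems in \<open>auto simp: less_SucI\<close>)
    ultimately have "exec (compile (\<rho>(x := b, y := b + 1)) (b + 2) e1 :: 'l com) ?s (?s(b + 2 := f i a))"
      by (simp only: f_def)
    then show ?thesis
      unfolding body_def using EIter.prems(2)[of "b + 2"]
      by (intro exec_eq[OF exec_Seq[OF _ exec_Seq[OF exec_clear exec_transfer]]]) (auto simp: fun_eq_iff)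
  qed
  have 3: "exec (While b body) (s(b := v, Suc b := a)) (s(b := 0, Suc b := loop f v a))" for v a
  proof (induction v arbitrary: a)
    case 0
    show ?case by (simp only: loop.simps) (rule exec_While_zero, simp)
  next
    case (Suc v)
    have "(s(b := Suc v, Suc b := a))(b := v) = s(b := v, Suc b := a)"
      by auto
    with step[of v a] Suc[of "f v a"] show ?case
      by (simp only: loop.simps) (rule exec_While_Suc[of "s(b := Suc v, Suc b := a)" b v], simp_all only:, simp)
  qed
  have 4: "exec (transfer (b + 1) b :: 'l com) (s(b := 0, Suc b := a)) (s(b := a))" for a
    using EIter.prems(2)[of "Suc b"] by (intro exec_eq[OF exec_transfer]) (auto simp: fun_eq_iff)
  show ?case
    using exec_Seq[OF 1 exec_Seq[OF 2 exec_Seq[OF 3 4]]]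
    by (simp only: f_def body_def compile.simps eval.simps)
next
  case (EApp a1 a2 a3 e)
  let ?v1 = "eval (s \<circ> \<rho>) a1" and ?v2 = "eval (s \<circ> \<rho>) a2" and ?v3 = "eval (s \<circ> \<rho>) a3"
  have b: "0 < b" and \<rho>: "\<rho> i < Suc b" "\<rho> i < Suc (Suc b)" for i
    using EApp.prems(1)[of i] by auto
  have ne: "\<rho> i \<noteq> b" "\<rho> i \<noteq> Suc b" for i
    using EApp.prems(1)[of i] by auto
  have env: "s(b := x) \<circ> \<rho> = s \<circ> \<rho>" "s(b := x, b + 1 := y) \<circ> \<rho> = s \<circ> \<rho>" for x y
    using ne by (auto simp: fun_eq_iff)
  let ?s = "s(b := ?v1, b + 1 := ?v2, b + 2 := ?v3)"
  \<comment> \<open>All further variables point to register 0, whose content 0 agrees with the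
    default value in \<open>args 0\<close>.\<close>
  have env': "?s \<circ> args 0 b (b + 1) (b + 2) = args 0 ?v1 ?v2 ?v3"
    using b EApp.prems(3) by (auto simp: fun_eq_iff args_def)
  have 1: "exec (compile \<rho> b a1 :: 'l com) s (s(b := ?v1))"
    by (rule EApp.IH(1)) (use EApp.prems in auto)
  have 2: "exec (compile \<rho> (b + 1) a2 :: 'l com) (s(b := ?v1)) (s(b := ?v1, b + 1 := ?v2))"
  proof -
    have "exec (compile \<rho> (b + 1) a2 :: 'l com) (s(b := ?v1)) (s(b := ?v1, b + 1 := eval (s(b := ?v1) \<circ> \<rho>) a2))"
      by (rule EApp.IH(2)) (use b \<rho> EApp.prems in auto)
    then show ?thesis unfolding env .
  qed
  have 3: "exec (compile \<rho> (b + 2) a3 :: 'l com) (s(b := ?v1, b + 1 := ?v2)) ?s"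
  proof -
    have "exec (compile \<rho> (b + 2) a3 :: 'l com) (s(b := ?v1, b + 1 := ?v2))
        (s(b := ?v1, b + 1 := ?v2, b + 2 := eval (s(b := ?v1, b + 1 := ?v2) \<circ> \<rho>) a3))"
      by (rule EApp.IH(3)) (use b \<rho> EApp.prems in auto)
    then show ?thesis unfolding env .
  qed
  have 4: "exec (compile (args 0 b (b + 1) (b + 2)) (b + 3) e :: 'l com) ?s (?s(b + 3 := eval (args 0 ?v1 ?v2 ?v3) e))"
    unfolding env'[symmetric] using b EApp.prems by (intro EApp.IH(4)) (auto simp: args_def)
  have "s b = 0" "s (b + 1) = 0" "s (b + 2) = 0" "s (b + 3) = 0"
    using EApp.prems(2) by auto
  then show ?case
    unfolding compile.simps eval.simps
    by (intro exec_eq[OF exec_Seq[OF 1 exec_Seq[OF 2 exec_Seq[OF 3 exec_Seq[OF 4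
        exec_Seq[OF exec_clear exec_Seq[OF exec_clear exec_Seq[OF exec_clear exec_transfer]]]]]]]])
      (auto simp: fun_eq_iff)
qed

section \<open>Arithmetic of codes\<close>

text \<open>Closed forms of the loops in the arithmetic programs below. The fourth gives the
  triangular number inside the pairing function; the last is a bounded search with at most one hit,
  since all other rounds keep the accumulator.\<close>

lemma loop_simps:
  "loop (\<lambda>i a. v) n v' = (if n = 0 then v' else v)"
  "loop (\<lambda>i a. Suc a) n m = m + n"
  "loop (\<lambda>i a. a - Suc 0) n m = m - n"
  "loop (\<lambda>i a. Suc (i + a)) n m = m + triangle n"
  "loop (\<lambda>i a. a div 2) n m = m div 2 ^ n"
  "loop (\<lambda>j a. if j = i then f j else a) n x = (if i < n then f i else x)"
  by (induction n arbitrary: m v' x) (auto simp: div_mult2_eq less_Suc_eq)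

lemma loop_cong: "(\<And>i a. i < n \<Longrightarrow> f i a = g i a) \<Longrightarrow> loop f n x = loop g n x"
  by (induction n arbitrary: x) auto

text \<open>Both components of a pair are at most its code, so trying all candidates up to
  \<open>z\<close> finds the unique preimage and inverts the pairing.\<close>

lemma loop_search_pair:
  "loop (\<lambda>x a. loop (\<lambda>y b. if prod_encode (x, y) = z then h x y else b) (Suc z) a) (Suc z) w =
     case_prod h (prod_decode z)"
proof -
  obtain x' y' where xy: "prod_decode z = (x', y')" by fastforce
  then have z: "z = prod_encode (x', y')" by (metis prod_decode_inverse)
  have "x' \<le> z" "y' \<le> z" unfolding z by (rule le_prod_encode_1, rule le_prod_encode_2)
  have "loop (\<lambda>y b. if prod_encode (x, y) = z then h x y else b) (Suc z) a =
      (if x = x' then h x y' else a)" for x a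
  proof (cases "x = x'")
    case True
    then have "loop (\<lambda>y b. if prod_encode (x, y) = z then h x y else b) (Suc z) a =
        loop (\<lambda>y b. if y = y' then h x y else b) (Suc z) a"
      by (intro loop_cong) (simp add: z)
    then show ?thesis
      using True \<open>y' \<le> z\<close> by (simp only: loop_simps(6)) auto
  next
    case False
    then have "loop (\<lambda>y b. if prod_encode (x, y) = z then h x y else b) (Suc z) a =
        loop (\<lambda>y b. if y = Suc z then b else b) (Suc z) a"
      by (intro loop_cong) (simp add: z)
    also have "loop (\<lambda>y b. if y = Suc z then b else b) n a = a" for n
      by (induction n) auto
    finally show ?thesis using False by simp
  qed
  then have "loop (\<lambda>x a. loop (\<lambda>y b. if prod_encode (x, y) = z then h x y else b) (Suc z) a) (Suc z) w =
      loop (\<lambda>x a. if x = x' then h x y' else a) (Suc z) w"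
    by (intro loop_cong) simp
  then show ?thesis
    using \<open>x' \<le> z\<close> xy by (simp only: loop_simps(6)[of x' "\<lambda>x. h x y'"]) auto
qed

definition e_const :: "nat \<Rightarrow> exp" where "e_const n = (ESuc ^^ n) EZero"

lemma eval_const [simp]: "eval \<sigma> (e_const n) = n"
  unfolding e_const_def by (induction n) auto

text \<open>A loop whose body ignores the accumulator: no round leaves the else value, any positive
  number of rounds the then value.\<close>

definition e_if :: "exp \<Rightarrow> exp \<Rightarrow> exp \<Rightarrow> exp" where
  "e_if c t e = EApp c t e (EIter 3 4 (EVar 0) (EVar 2) (EVar 1))"

lemma eval_if: "eval \<sigma> (e_if c t e) = (if eval \<sigma> c = 0 then eval \<sigma> e else eval \<sigma> t)"
  by (simp add: e_if_def loop_simps)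

definition e_add :: "exp \<Rightarrow> exp \<Rightarrow> exp" where
  "e_add a b = EApp a b EZero (EIter 3 4 (EVar 1) (EVar 0) (ESuc (EVar 4)))"

lemma eval_add [simp]: "eval \<sigma> (e_add a b) = eval \<sigma> a + eval \<sigma> b"
  by (simp add: e_add_def loop_simps)

definition e_sub :: "exp \<Rightarrow> exp \<Rightarrow> exp" where
  "e_sub a b = EApp a b EZero (EIter 3 4 (EVar 1) (EVar 0) (EPred (EVar 4)))"

lemma eval_sub [simp]: "eval \<sigma> (e_sub a b) = eval \<sigma> a - eval \<sigma> b"
  by (simp add: e_sub_def loop_simps)

definition e_eq :: "exp \<Rightarrow> exp \<Rightarrow> exp" where
  "e_eq a b = e_if (e_add (e_sub a b) (e_sub b a)) EZero (ESuc EZero)"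

lemma eval_eq [simp]: "eval \<sigma> (e_eq a b) = (if eval \<sigma> a = eval \<sigma> b then 1 else 0)"
  by (auto simp: e_eq_def eval_if)

lemma eval_if_eq [simp]:
  "eval \<sigma> (e_if (e_eq a b) t e) = (if eval \<sigma> a = eval \<sigma> b then eval \<sigma> t else eval \<sigma> e)"
  by (simp add: eval_if)

definition e_pair :: "exp \<Rightarrow> exp \<Rightarrow> exp" where
  "e_pair a b = EApp a b EZero
     (e_add (EIter 3 4 (e_add (EVar 0) (EVar 1)) EZero (ESuc (e_add (EVar 3) (EVar 4)))) (EVar 0))"

lemma eval_pair [simp]: "eval \<sigma> (e_pair a b) = prod_encode (eval \<sigma> a, eval \<sigma> b)"
  by (simp add: e_pair_def loop_simps prod_encode_def)

text \<open>Variables 3 and 5 run over the candidate components, 4 and 6 accumulate;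
  \<open>h\<close> selects the component to keep.\<close>

definition e_unpair :: "exp \<Rightarrow> exp \<Rightarrow> exp" where
  "e_unpair h z = EApp z EZero EZero (EIter 3 4 (ESuc (EVar 0)) EZero
     (EIter 5 6 (ESuc (EVar 0)) (EVar 4) (e_if (e_eq (e_pair (EVar 3) (EVar 5)) (EVar 0)) h (EVar 6))))"

definition e_fst :: "exp \<Rightarrow> exp" where "e_fst = e_unpair (EVar 3)"
definition e_snd :: "exp \<Rightarrow> exp" where "e_snd = e_unpair (EVar 5)"

lemma eval_fst [simp]: "eval \<sigma> (e_fst z) = fst (prod_decode (eval \<sigma> z))"
  using loop_search_pair[where h = "\<lambda>x y. x" and w = 0]
  by (simp add: e_fst_def e_unpair_def case_prod_unfold cong: if_cong del: loop.simps)

lemma eval_snd [simp]: "eval \<sigma> (e_snd z) = snd (prod_decode (eval \<sigma> z))"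
  using loop_search_pair[where h = "\<lambda>x y. y" and w = 0]
  by (simp add: e_snd_def e_unpair_def case_prod_unfold cong: if_cong del: loop.simps)

text \<open>With truncated subtraction the two sides can agree only at 0, that is if
  \<open>2i \<le> n\<close> and \<open>n \<le> 2i + 1\<close>, so the search hits exactly the
  half.\<close>

definition e_half :: "exp \<Rightarrow> exp" where
  "e_half n = EApp n EZero EZero (EIter 3 4 (ESuc (EVar 0)) EZero
     (e_if (e_eq (e_sub (EVar 0) (ESuc (e_add (EVar 3) (EVar 3)))) (e_sub (e_add (EVar 3) (EVar 3)) (EVar 0))) (EVar 3) (EVar 4)))"

lemma eval_half [simp]: "eval \<sigma> (e_half n) = eval \<sigma> n div 2"
proof -
  have *: "n - Suc (i + i) = i + i - n \<longleftrightarrow> i = n div 2" for i n :: nat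
    by presburger
  show ?thesis
    by (simp add: e_half_def * loop_simps(6)[of _ "\<lambda>_. eval \<sigma> n div 2"] cong: if_cong del: loop.simps)
qed

definition e_bit :: "exp \<Rightarrow> exp \<Rightarrow> exp" where
  "e_bit x m = EApp (EApp x m EZero (EIter 3 4 (EVar 1) (EVar 0) (e_half (EVar 4)))) EZero EZero
     (e_sub (EVar 0) (e_add (e_half (EVar 0)) (e_half (EVar 0))))"

lemma eval_bit [simp]: "eval \<sigma> (e_bit x m) = (if eval \<sigma> m \<in> set_decode (eval \<sigma> x) then 1 else 0)"
proof -
  have "n - (n div 2 + n div 2) = (if odd n then 1 else 0)" for n :: nat
    by presburger
  then show ?thesis
    by (simp add: e_bit_def loop_simps set_decode_def)
qed

lemma eval_if_bit [simp]:
  "eval \<sigma> (e_if (e_bit x m) t e) = (if eval \<sigma> m \<in> set_decode (eval \<sigma> x) then eval \<sigma> t else eval \<sigma> e)"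
  by (simp add: eval_if)

definition e_cons :: "exp \<Rightarrow> exp \<Rightarrow> exp" where "e_cons x l = ESuc (e_pair x l)"
definition e_hd :: "nat \<Rightarrow> exp \<Rightarrow> exp" where "e_hd n l = e_if l (e_fst (EPred l)) (e_const n)"
definition e_tl :: "exp \<Rightarrow> exp" where "e_tl l = e_snd (EPred l)"

text \<open>This makes the empty list, whose code is 0, its own tail under
  \<open>e_tl\<close>.\<close>

lemma prod_decode_0: "prod_decode 0 = (0, 0)"
  by (simp add: prod_decode_def prod_decode_aux.simps)

lemma eval_list:
  "eval \<sigma> l = list_encode xs \<Longrightarrow> eval \<sigma> (e_cons x l) = list_encode (eval \<sigma> x # xs)"
  "eval \<sigma> l = list_encode xs \<Longrightarrow> eval \<sigma> (e_hd n l) = last_default n (rev xs)"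
  "eval \<sigma> l = list_encode xs \<Longrightarrow> eval \<sigma> (e_tl l) = list_encode (tl xs)"
  by (cases xs; simp add: e_cons_def e_hd_def e_tl_def eval_if last_default_def prod_decode_0)+

lemma loop_tl:
  "loop (\<lambda>i a. snd (prod_decode (a - Suc 0))) n (list_encode xs) = list_encode (drop n xs)"
proof (induction n arbitrary: xs)
  case (Suc n)
  have "snd (prod_decode (list_encode xs - Suc 0)) = list_encode (tl xs)"
    by (cases xs) (simp_all add: prod_decode_0)
  then show ?case by (simp add: Suc drop_Suc)
qed simp

lemma loop_filter:
  "loop (\<lambda>m a. if Q m then Suc (prod_encode (h m, a)) else a) n (list_encode xs) =
     list_encode (map h (filter Q [0..<n]) @ xs)"
proof (induction n arbitrary: xs)
  case (Suc n)
  show ?case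
    using Suc[of xs] Suc[of "h n # xs"] by simp
qed simp

text \<open>
  Configurations are coded as nested pairs (state, head symbol, left stack, right stack), so that their
  first two components match those of \<open>trans_code\<close>.
\<close>
definition proj :: "nat \<Rightarrow> nat \<Rightarrow> nat" where
  "proj n x = fst (prod_decode (((snd \<circ> prod_decode) ^^ n) x))"

definition proj_last :: "nat \<Rightarrow> nat \<Rightarrow> nat" where
  "proj_last n x = ((snd \<circ> prod_decode) ^^ n) x"

definition e_proj_last :: "nat \<Rightarrow> exp \<Rightarrow> exp" where
  "e_proj_last n x = (e_snd ^^ n) x"

definition e_proj :: "nat \<Rightarrow> exp \<Rightarrow> exp" where
  "e_proj n x = e_fst (e_proj_last n x)"

lemma eval_proj [simp]:
  "eval \<sigma> (e_proj_last n x) = proj_last n (eval \<sigma> x)" "eval \<sigma> (e_proj n x) = proj n (eval \<sigma> x)"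
proof -
  show "eval \<sigma> (e_proj_last n x) = proj_last n (eval \<sigma> x)"
    unfolding e_proj_last_def proj_last_def by (induction n) auto
  then show "eval \<sigma> (e_proj n x) = proj n (eval \<sigma> x)"
    by (simp add: e_proj_def proj_last_def proj_def)
qed

lemma proj_simps [simp]:
  "proj 0 (prod_encode (x, y)) = x" "proj_last 0 y = y"
  "proj (Suc n) (prod_encode (x, y)) = proj n y" "proj_last (Suc n) (prod_encode (x, y)) = proj_last n y"
  "proj (numeral k) (prod_encode (x, y)) = proj (pred_numeral k) y"
  "proj_last (numeral k) (prod_encode (x, y)) = proj_last (pred_numeral k) y"
  by (simp_all add: proj_def proj_last_def numeral_eq_Suc funpow_swap1 del: funpow.simps) (simp_all add: funpow_swap1)

section \<open>Programs on codes of machines and configurations\<close>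

definition enabled :: "nat \<Rightarrow> nat \<Rightarrow> nat list" where
  "enabled T c = filter (\<lambda>m. m \<in> set_decode T \<and> proj 0 m = proj 0 c \<and> proj 1 m = proj 1 c) [0..<T]"

text \<open>The menu and the update share this enumeration: the former stores the label of each code
  through \<open>h\<close>, the latter the code itself, so an index means the same transition in
  both. Variable 3 runs over all numbers below \<open>T\<close>, which suffices since the elements
  of a coded set are smaller than its code.\<close>

definition e_enabled :: "exp \<Rightarrow> exp \<Rightarrow> exp \<Rightarrow> exp" where
  "e_enabled h T c = EApp T c EZero (EIter 3 4 (EVar 0) EZero
     (e_if (e_bit (EVar 0) (EVar 3))
       (e_if (e_eq (e_proj 0 (EVar 3)) (e_proj 0 (EVar 1)))
         (e_if (e_eq (e_proj 1 (EVar 3)) (e_proj 1 (EVar 1))) (e_cons h (EVar 4)) (EVar 4)) (EVar 4)) (EVar 4)))"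

lemma eval_enabled:
  assumes "\<And>\<sigma>. eval \<sigma> h = f (\<sigma> 3)"
  shows "eval \<sigma> (e_enabled h T c) = list_encode (map f (enabled (eval \<sigma> T) (eval \<sigma> c)))"
proof -
  let ?T = "eval \<sigma> T" and ?c = "eval \<sigma> c"
  have "eval \<sigma> (e_enabled h T c) = loop (\<lambda>m a. if m \<in> set_decode ?T \<and> proj 0 m = proj 0 ?c \<and> proj 1 m = proj 1 ?c
      then Suc (prod_encode (f m, a)) else a) ?T (list_encode [])"
    unfolding e_enabled_def e_cons_def eval.simps
    by (auto simp: assms intro!: loop_cong)
  then show ?thesis
    unfolding loop_filter by (simp add: enabled_def)
qed

text \<open>\<open>k\<close> stands for the code of the blank: \<open>to_nat\<close> is unspecified,
  so this number is built into the machine as a constant.\<close>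

definition e_init :: "nat \<Rightarrow> exp" where
  "e_init k = e_pair (e_proj 2 (EVar 0)) (e_pair (e_const k) (e_pair EZero EZero))"

text \<open>Variable 0 is the Goedel number, variable 1 the configuration. The first entry is the
  finality flag and the others are label codes, so one number describes a whole offering
  state.\<close>

definition e_offer :: exp where
  "e_offer = e_cons (e_bit (e_proj_last 3 (EVar 0)) (e_proj 0 (EVar 1)))
     (e_enabled (e_proj 2 (EVar 3)) (e_proj 1 (EVar 0)) (EVar 1))"

text \<open>Here variable 0 is the code of the chosen transition. A nonzero direction is a move to
  the right; \<open>e_hd k\<close> supplies a blank when the head leaves the stored part.\<close>

definition e_update :: "nat \<Rightarrow> exp" where
  "e_update k =
     (let t = e_proj_last 5 (EVar 0); e = e_proj 3 (EVar 0); l = e_proj 2 (EVar 1); r = e_proj_last 3 (EVar 1) in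
      e_if (e_proj 4 (EVar 0))
        (e_pair t (e_pair (e_hd k r) (e_pair (e_cons e l) (e_tl r))))
        (e_pair t (e_pair (e_hd k l) (e_pair (e_tl l) (e_cons e r)))))"

definition e_next :: "nat \<Rightarrow> exp" where
  "e_next k = EApp (e_hd 0 (EIter 3 4 (EVar 2) (e_enabled (EVar 3) (e_proj 1 (EVar 0)) (EVar 1)) (e_tl (EVar 4))))
     (EVar 1) EZero (e_update k)"

lemma eval_offer:
  "eval \<sigma> e_offer = list_encode ((if proj 0 (\<sigma> 1) \<in> set_decode (proj_last 3 (\<sigma> 0)) then 1 else 0) #
     map (proj 2) (enabled (proj 1 (\<sigma> 0)) (\<sigma> 1)))"
proof -
  have "eval \<sigma> (e_enabled (e_proj 2 (EVar 3)) (e_proj 1 (EVar 0)) (EVar 1)) =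
      list_encode (map (proj 2) (enabled (proj 1 (\<sigma> 0)) (\<sigma> 1)))"
    by (subst eval_enabled) auto
  from eval_list(1)[OF this] show ?thesis
    unfolding e_offer_def by simp
qed

lemma eval_next:
  assumes "\<sigma> 2 < length (enabled (proj 1 (\<sigma> 0)) (\<sigma> 1))"
  shows "eval \<sigma> (e_next k) =
    eval (args 0 (enabled (proj 1 (\<sigma> 0)) (\<sigma> 1) ! \<sigma> 2) (\<sigma> 1) 0) (e_update k)"
proof -
  let ?ms = "enabled (proj 1 (\<sigma> 0)) (\<sigma> 1)"
  have "eval \<sigma> (e_enabled (EVar 3) (e_proj 1 (EVar 0)) (EVar 1)) = list_encode ?ms"
    by (subst eval_enabled[of _ "\<lambda>x. x"]) auto
  then have "eval \<sigma> (EIter 3 4 (EVar 2) (e_enabled (EVar 3) (e_proj 1 (EVar 0)) (EVar 1)) (e_tl (EVar 4))) =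
      list_encode (drop (\<sigma> 2) ?ms)"
    by (simp add: e_tl_def loop_tl)
  from eval_list(2)[OF this, of 0]
  have "eval \<sigma> (e_hd 0 (EIter 3 4 (EVar 2) (e_enabled (EVar 3) (e_proj 1 (EVar 0)) (EVar 1)) (e_tl (EVar 4)))) =
      ?ms ! \<sigma> 2"
    using assms by (simp add: last_default_def last_rev hd_drop_conv_nth)
  then show ?thesis
    unfolding e_next_def by simp
qed

text \<open>The left side is reversed, so that both sides are stacks with the cell next to the head
  on top. The code is that of a raw tape: one tape instance has many codes.\<close>

fun config_code :: "nat \<Rightarrow> 'd::countable raw_tape \<Rightarrow> nat" where
  "config_code s (l, d, r) = prod_encode (s, prod_encode (to_nat d,
     prod_encode (list_encode (map to_nat (rev l)), list_encode (map to_nat r))))"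

lemma eval_init:
  fixes M :: "('a::countable, 'c::finite, 'd::finite) rtm"
  assumes "\<sigma> 0 = godel M"
  shows "eval \<sigma> (e_init (to_nat (blank :: 'd option))) = config_code (rinit M) ([], blank :: 'd option, [])"
  using assms by (simp add: e_init_def godel_def)

lemma last_default_map: "last_default (f z) (map f xs) = f (last_default z xs)"
  by (simp add: last_default_def last_map)

lemma eval_update:
  fixes x :: "nat \<times> ('d::finite) option \<times> ('a::countable, 'c::finite, 'd) action option \<times> 'd option \<times> direction \<times> nat"
  assumes "x = (s, d, a, e, X, t)"
  shows "eval (args 0 (trans_code x) (config_code s (l, d, r)) 0) (e_update (to_nat (blank :: 'd option))) =
    config_code t (raw_move X e (l, d, r))"
proof -
  define \<sigma> where "\<sigma> = args 0 (trans_code x) (config_code s (l, d, r)) 0"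
  have l: "eval \<sigma> (e_proj 2 (EVar 1)) = list_encode (map to_nat (rev l))"
    and r: "eval \<sigma> (e_proj_last 3 (EVar 1)) = list_encode (map to_nat r)"
    by (simp_all add: \<sigma>_def)
  have e: "eval \<sigma> (e_proj 3 (EVar 0)) = to_nat e" and t: "eval \<sigma> (e_proj_last 5 (EVar 0)) = t"
    and X: "eval \<sigma> (e_proj 4 (EVar 0)) = (case X of MoveL \<Rightarrow> 0 | MoveR \<Rightarrow> 1)"
    by (simp_all add: \<sigma>_def assms)
  have tl: "map to_nat (rev (butlast l)) = tl (map to_nat (rev l))" "map to_nat (tl r) = tl (map to_nat r)"
    by (cases l rule: rev_cases; simp) (simp add: map_tl)
  show ?thesis
    unfolding \<sigma>_def[symmetric] e_update_def Let_def eval_if X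
    by (cases X) (simp_all add: e t tl eval_list(1)[OF l] eval_list(1)[OF r] eval_list(2)[OF l] eval_list(2)[OF r]
        eval_list(3)[OF l] eval_list(3)[OF r] last_default_map[of to_nat, symmetric] rev_map
        del: eval_proj trans_code.simps One_nat_def)
qed

section \<open>The universal machine\<close>

text \<open>The bridge from a computed number to a control state: every value up to \<open>n\<close>
  gets its own branch, entered with \<open>r\<close> counted down to 0.\<close>

fun switch :: "nat \<Rightarrow> nat \<Rightarrow> (nat \<Rightarrow> 'l com) \<Rightarrow> 'l com" where
  "switch r 0 f = f 0"
| "switch r (Suc n) f = IfDec r (switch r n (\<lambda>i. f (Suc i))) (f 0)"

lemma cstep_Seq: "(((a ;; b) # ks, s), (a # b # ks, s)) \<in> cstep"
  by (simp add: cstep_def)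

lemma cstep_While_Suc: "s r = Suc j \<Longrightarrow> ((While r c # ks, s), (c # While r c # ks, s(r := j))) \<in> cstep"
  by (auto simp: cstep_def)

lemma csteps_exec: "exec c s t \<Longrightarrow> ((ks, t), z) \<in> cstep\<^sup>* \<Longrightarrow> ((c # ks, s), z) \<in> cstep\<^sup>*"
  unfolding exec_def by (meson rtrancl_trans)

lemma csteps_Seq: "((a # b # ks, s), z) \<in> cstep\<^sup>* \<Longrightarrow> (((a ;; b) # ks, s), z) \<in> cstep\<^sup>*"
  by (meson cstep_Seq converse_rtrancl_into_rtrancl)

lemma csteps_Seq_exec:
  "exec a s t \<Longrightarrow> ((b # ks, t), z) \<in> cstep\<^sup>* \<Longrightarrow> (((a ;; b) # ks, s), z) \<in> cstep\<^sup>*"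
  by (rule csteps_Seq, rule csteps_exec)

lemma csteps_refl: "s = t \<Longrightarrow> ((ks, s), (ks, t)) \<in> cstep\<^sup>*"
  by simp

lemma csteps_switch:
  "s r \<le> n \<Longrightarrow> ((switch r n f # ks, s), (f (s r) # ks, s(r := 0))) \<in> cstep\<^sup>*"
proof (induction n arbitrary: f s)
  case 0
  then show ?case by (simp add: fun_upd_idem)
next
  case (Suc n)
  show ?case
  proof (cases "s r")
    case 0
    then have "((switch r (Suc n) f # ks, s), (f (s r) # ks, s(r := 0))) \<in> cstep"
      by (auto simp: cstep_def fun_upd_idem)
    then show ?thesis by blast
  next
    case (Suc j)
    then have "((switch r (Suc n) f # ks, s), (switch r n (\<lambda>i. f (Suc i)) # ks, s(r := j))) \<in> cstep"
      by (auto simp: cstep_def)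
    also have "((switch r n (\<lambda>i. f (Suc i)) # ks, s(r := j)), (f (s r) # ks, s(r := 0))) \<in> cstep\<^sup>*"
      using Suc.IH[of "s(r := j)" "\<lambda>i. f (Suc i)"] Suc Suc.prems
      by (simp add: fun_upd_same del: fun_upd_apply)
    finally show ?thesis .
  qed
qed

lemma csteps_replicate: "((replicate i (Inc r) @ ks, s), (ks, s(r := s r + i))) \<in> cstep\<^sup>*"
proof (induction i arbitrary: s)
  case (Suc i)
  have "((replicate (Suc i) (Inc r) @ ks, s), (replicate i (Inc r) @ ks, s(r := Suc (s r)))) \<in> cstep"
    by (auto simp: cstep_def)
  also have "((replicate i (Inc r) @ ks, s(r := Suc (s r))), (ks, s(r := s r + Suc i))) \<in> cstep\<^sup>*"
    using Suc[of "s(r := Suc (s r))"] by (simp add: fun_upd_same del: fun_upd_apply)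
  finally show ?case .
qed (simp add: fun_upd_idem)

lemma com_acts_compile [simp]: "com_acts (compile \<rho> b e) = {}"
  by (induction e arbitrary: \<rho> b) (auto simp: copy_def transfer_def)

lemma com_acts_switch: "com_acts (switch r n f) \<subseteq> (\<Union>i. com_acts (f i))"
proof (induction n arbitrary: f)
  case (Suc n)
  from Suc[of "\<lambda>i. f (Suc i)"] show ?case by auto
qed auto

lemma set_decode_less: "n \<in> set_decode x \<Longrightarrow> n < x"
proof -
  assume "n \<in> set_decode x"
  then have "x div 2 ^ n \<noteq> 0"
    by (metis even_zero mem_Collect_eq set_decode_def)
  then have "2 ^ n \<le> x"
    by (meson div_less not_le)
  then show "n < x"
    using less_exp[of n] by linarith
qed

lemma ts_of_states:
  assumes "is_rtm A M" "(x, a, y) \<in> transitions (ts_of M)"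
  shows "x \<in> states (ts_of M)" "y \<in> states (ts_of M)" "a \<in> insert tau (Some ` A)"
proof -
  obtain s t z z' where "x = (s, t)" "y = (z, z')" by (cases x; cases y)
  then show "x \<in> states (ts_of M)" "y \<in> states (ts_of M)" "a \<in> insert tau (Some ` A)"
    using assms by (auto simp: transitions_ts_of is_rtm_def) (auto simp: ts_of_def)
qed

lemma move_Tape_raw: "move X e (Tape l d r) = (case raw_move X e (l, d, r) of (l', d', r') \<Rightarrow> Tape l' d' r')"
  by (cases X) (simp_all add: Tape.abs_eq move.abs_eq)

lemma proj_godel:
  fixes M :: "('a::countable, 'c::finite, 'd::finite) rtm"
  assumes "finite A" "is_rtm A M"
  shows "set_decode (proj 1 (godel M)) = trans_code ` rtrans M"
    "set_decode (proj_last 3 (godel M)) = rfinals M"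
proof -
  have "finite (rfinals M)"
    using assms(2) by (auto simp: is_rtm_def intro: finite_subset)
  then show "set_decode (proj 1 (godel M)) = trans_code ` rtrans M"
    "set_decode (proj_last 3 (godel M)) = rfinals M"
    using finite_rtrans[OF assms] by (simp_all add: godel_def)
qed

lemma set_enabled:
  fixes M :: "('a::countable, 'c::finite, 'd::finite) rtm"
  assumes "finite A" "is_rtm A M"
  shows "set (enabled (proj 1 (godel M)) (config_code s (l, d :: 'd option, r))) = trans_code ` {x \<in> rtrans M. \<exists>y. x = (s, d, y)}"
proof -
  let ?T = "proj 1 (godel M)"
  have c: "proj 0 (config_code s (l, d, r)) = s" "proj 1 (config_code s (l, d, r)) = to_nat d"
    by simp_all
  have x: "proj 0 (trans_code x) = fst x" "proj 1 (trans_code x) = to_nat (fst (snd x))"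
    "(\<exists>y. x = (s, d, y)) \<longleftrightarrow> fst x = s \<and> fst (snd x) = d"
    for x :: "nat \<times> 'd option \<times> ('a, 'c, 'd) action option \<times> 'd option \<times> direction \<times> nat"
    by (cases x; simp)+
  have "set (enabled ?T (config_code s (l, d, r))) = {m \<in> set_decode ?T. proj 0 m = s \<and> proj 1 m = to_nat d}"
    unfolding enabled_def c using set_decode_less by auto
  also have "\<dots> = {m \<in> trans_code ` rtrans M. proj 0 m = s \<and> proj 1 m = to_nat d}"
    by (simp only: proj_godel[OF assms])
  also have "\<dots> = trans_code ` {x \<in> rtrans M. \<exists>y. x = (s, d, y)}"
  proof -
    have "{m \<in> trans_code ` rtrans M. P m} = trans_code ` {x \<in> rtrans M. P (trans_code x)}" for P by auto
    then show ?thesis by (simp only: x inj_eq[OF inj_to_nat])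
  qed
  finally show ?thesis .
qed

text \<open>On a particular tape two table entries may give the same transition, for instance
  writing a blank on an empty tape and moving left or right. The enabled entries depend only on
  \<open>s\<close> and \<open>d\<close>, so they can be counted on a tape with nonblank symbols on
  both sides of \<open>d\<close>, where different entries have different effects.\<close>

lemma length_enabled:
  fixes M :: "('a::countable, 'c::finite, 'd::finite) rtm"
  assumes "finite A" "is_rtm A M" "branching_bounded B (ts_of M)" "s \<in> rstates M"
  shows "length (enabled (proj 1 (godel M)) (config_code s (l, d :: 'd option, r))) \<le> B"
proof -
  let ?E = "enabled (proj 1 (godel M)) (config_code s (l, d, r))"
  let ?X = "{x \<in> rtrans M. \<exists>y. x = (s, d, y)}"
  define z :: "'d option" where "z = Some (SOME d. True)"
  define x where "x = Tape [z] d [z]"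
  let ?f = "\<lambda>(s :: nat, d :: 'd option, a :: ('a, 'c, 'd) action option, e, X, t :: nat). (a, t, move X e x)"
  have move: "move X e x = move X' e' x \<Longrightarrow> X = X' \<and> e = e'" for X X' e e'
    by (cases X; cases X')
       (auto simp: x_def z_def Tape.abs_eq move.abs_eq tape.abs_eq_iff tape_eq_iff last_default_def)
  let ?S = "{(a, t). ((s, x), a, t) \<in> transitions (ts_of M)}"
  have "(s, x) \<in> states (ts_of M)"
    using assms(4) by (simp add: ts_of_def)
  then have bound: "finite ?S" "card ?S \<le> B"
    using assms(3) by (simp_all add: branching_bounded_def)
  have sub: "?f ` ?X \<subseteq> ?S"
    by (auto simp: transitions_ts_of x_def)
  have inj: "inj_on ?f ?X"
    by (rule inj_onI, safe, simp_all) (use move in blast)+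
  have "length ?E = card (set ?E)"
    by (rule distinct_card[symmetric]) (simp add: enabled_def)
  also have "\<dots> = card ?X"
    unfolding set_enabled[OF assms(1,2)] by (intro card_image inj_on_subset[OF inj_trans_code]) simp
  also have "\<dots> = card (?f ` ?X)"
    by (rule card_image[OF inj, symmetric])
  also have "\<dots> \<le> card ?S"
    by (rule card_mono[OF bound(1) sub])
  finally show ?thesis using bound(2) by simp
qed

section \<open>The program of the universal machine\<close>

locale universal =
  fixes A :: "('a::countable, 'c::finite, 'd::finite) action set" and u :: 'c and B :: nat
  assumes finite_A: "finite A" and comm_A: "comm_actions UNIV \<subseteq> A"
begin

definition labels :: "('a, 'c, 'd) action option set" where
  "labels = insert tau (Some ` A)"

definition offer_code :: "bool \<Rightarrow> ('a, 'c, 'd) action option list \<Rightarrow> nat" where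
  "offer_code fin as = list_encode ((if fin then 1 else 0) # map to_nat as)"

text \<open>Here \<open>B\<close> enters the machine: there are only finitely many lists of length
  at most \<open>B\<close> over the finite set of labels, hence a common bound for the codes of all
  menus.\<close>

lemma offer_code_bounded:
  "\<exists>n. \<forall>fin as. set as \<subseteq> labels \<longrightarrow> length as \<le> B \<longrightarrow> offer_code fin as \<le> n"
proof -
  let ?X = "{as. set as \<subseteq> labels \<and> length as \<le> B}"
  have "finite ?X"
    using finite_A by (intro finite_lists_length_le) (simp add: labels_def)
  then have fin: "finite (case_prod offer_code ` (UNIV \<times> ?X))" by simp
  show ?thesis
    by (intro exI[of _ "Max (case_prod offer_code ` (UNIV \<times> ?X))"] allI impI Max_ge[OF fin]) auto
qed

definition bound :: nat where
  "bound = (SOME n. \<forall>fin as. set as \<subseteq> labels \<longrightarrow> length as \<le> B \<longrightarrow> offer_code fin as \<le> n)"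

lemma offer_code_le: "set as \<subseteq> labels \<Longrightarrow> length as \<le> B \<Longrightarrow> offer_code fin as \<le> bound"
  unfolding bound_def using someI_ex[OF offer_code_bounded] by blast

text \<open>\<open>switch\<close> has a branch for every number up to \<open>bound\<close>,
  including numbers that code no legal menu; the filter keeps their labels within the allowed
  set.\<close>

definition offer_of :: "nat \<Rightarrow> ('a, 'c, 'd) action com" where
  "offer_of v = Offer (hd (list_decode v) = 1) 4
     (filter (\<lambda>a. a \<in> labels) (map from_nat (tl (list_decode v))))"

lemma offer_of: "set as \<subseteq> labels \<Longrightarrow> offer_of (offer_code fin as) = Offer fin 4 as"
  by (auto simp: offer_of_def offer_code_def o_def intro!: filter_True simp del: list_encode.simps)

text \<open>
  Register 1 holds the Goedel number, register 2 the configuration, register 3 the loop flag, and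
  register 4 the index of the chosen transition.
\<close>
definition vars :: "nat \<Rightarrow> nat" where "vars = args 0 1 2 4"

text \<open>The same choice as in \<open>unary\<close>, so the machine listens for the symbol that
  is sent.\<close>

definition mark :: 'd where "mark = (SOME d. True)"

text \<open>The index left in register 4 is 0 for the final blank and 1 for a digit. A digit raises
  the number and sets the loop flag again; the blank leaves the flag at 0, which ends the
  loop.\<close>

definition receive :: "('a, 'c, 'd) action com" where
  "receive = Offer False 4 [Some (Recv u blank), Some (Recv u (Some mark))] ;; IfDec 4 (Inc 1 ;; Inc 3) Skip"

definition continue :: "('a, 'c, 'd) action com" where
  "continue = compile vars 5 (e_next (to_nat (blank :: 'd option))) ;; clear 4 ;; clear 2 ;; transfer 5 2 ;; Inc 3"

text \<open>The test consumes the loop flag and \<open>continue\<close> sets it again, so the loop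
  never ends and the flag is 0 whenever an offer is made.\<close>

definition simulate :: "('a, 'c, 'd) action com" where
  "simulate = While 3 (compile vars 5 e_offer ;; switch 5 bound offer_of ;; continue)"

definition prepare :: "('a, 'c, 'd) action com" where
  "prepare = compile vars 5 (e_init (to_nat (blank :: 'd option))) ;; transfer 5 2 ;; Inc 3 ;; simulate"

definition main :: "('a, 'c, 'd) action com" where
  "main = Inc 3 ;; While 3 receive ;; prepare"

definition Q :: "('a, 'c, 'd) action com list set" where
  "Q = insert [] (conts main [])"

text \<open>One track for each register up to the largest one in use, and track 0.\<close>

definition k :: nat where
  "k = Suc (Suc (Max ((\<lambda>q. reg (instr_of q)) ` Q)))"

sublocale register_machine A instr_of Q "[main]" k mark
proof
  show fin: "finite Q" by (simp add: Q_def finite_conts)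
  show "[main] \<in> Q" by (simp add: Q_def conts_start)
  fix q assume q: "q \<in> Q"
  show "succs (instr_of q) \<subseteq> Q"
    using q conts_closed[of q main "[]"] by (auto simp: Q_def)
  have "com_acts main \<subseteq> insert tau (Some ` A)"
  proof -
    have "com_acts (switch 5 bound offer_of) \<subseteq> insert tau (Some ` A)"
      using com_acts_switch[of 5 bound offer_of] by (force simp: offer_of_def labels_def)
    moreover have "Recv u d \<in> A" for d
      using comm_A by (auto simp: comm_actions_def)
    ultimately show ?thesis
      by (auto simp: main_def receive_def prepare_def simulate_def continue_def transfer_def)
  qed
  then show "acts (instr_of q) \<subseteq> insert tau (Some ` A)"
    using q conts_acts[of q main "[]"] by (auto simp: Q_def)
  show "Suc (reg (instr_of q)) < k"
    unfolding k_def using q fin by (simp add: less_Suc_eq_le)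
qed

text \<open>Carrying membership in \<open>Q\<close> along also shows, without unfolding
  \<open>conts\<close>, that the control states met later belong to the machine.\<close>

lemma csteps_run:
  assumes "((q, s), (q', s')) \<in> cstep\<^sup>*" "q \<in> Q"
  shows "q' \<in> Q \<and> (home q s, home q' s') \<in> run"
  using assms(1)
proof (induction rule: rtrancl_induct2)
  case refl
  then show ?case using assms(2) by simp
next
  case (step q1 s1 q2 s2)
  from step.hyps(2) consider r where "instr_of q1 = IInc r q2" "s2 = s1(r := Suc (s1 r))"
    | r q3 j where "instr_of q1 = IDec r q2 q3" "s1 r = Suc j" "s2 = s1(r := j)"
    | r q3 where "instr_of q1 = IDec r q3 q2" "s1 r = 0" "s2 = s1"
    | "instr_of q1 = IOffer False [(tau, q2)]" "s2 = s1"
    by (auto simp: cstep_def)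
  then have "q2 \<in> Q \<and> (home q1 s1, home q2 s2) \<in> run"
  proof cases
    case 1
    then show ?thesis using step.IH succs_Q[of q1] run_inc[of q1] by auto
  next
    case 2
    then show ?thesis using step.IH succs_Q[of q1] run_dec_Suc[of q1 r q2 q3 s1 j] by auto
  next
    case 3
    then show ?thesis using step.IH succs_Q[of q1] run_dec_zero[of q1 r q3 q2 s1] by auto
  next
    case 4
    then show ?thesis using step.IH succs_Q[of q1] run_nop[of q1 q2] by auto
  qed
  with step.IH show ?case by (meson rtrancl_trans)
qed

definition memory :: "nat \<Rightarrow> nat \<Rightarrow> nat \<Rightarrow> nat" where
  "memory g c = (\<lambda>_. 0)(1 := g, 2 := c)"

lemma exec_compile_memory:
  "exec (compile vars 5 e) ((memory g c)(4 := i)) ((memory g c)(4 := i, 5 := eval (args 0 g c i) e))"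
proof -
  have "((memory g c)(4 := i)) \<circ> vars = args 0 g c i"
    by (auto simp: fun_eq_iff memory_def vars_def args_def)
  moreover have "exec (compile vars 5 e) ((memory g c)(4 := i))
      ((memory g c)(4 := i, 5 := eval ((memory g c)(4 := i) \<circ> vars) e))"
    by (rule exec_compile) (auto simp: vars_def args_def memory_def)
  ultimately show ?thesis
    by (simp only:)
qed

lemma memory_4: "(memory g c)(4 := 0) = memory g c"
  by (auto simp: memory_def)

definition offering :: "nat \<Rightarrow> nat \<Rightarrow> ('a, 'c, 'd) action com list" where
  "offering g c = [offer_of (eval (args 0 g c 0) e_offer), continue, simulate]"

lemma csteps_simulate:
  assumes "eval (args 0 g c 0) e_offer \<le> bound"
  shows "(([simulate], (memory g c)(3 := 1)), (offering g c, memory g c)) \<in> cstep\<^sup>*"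
proof -
  let ?v = "eval (args 0 g c 0) e_offer" and ?body = "compile vars 5 e_offer ;; switch 5 bound offer_of ;; continue"
  have m: "(memory g c)(3 := 1, 3 := 0) = memory g c" "(memory g c)(5 := ?v, 5 := 0) = memory g c"
    by (auto simp: memory_def)
  have "(([simulate], (memory g c)(3 := 1)), ([?body, simulate], (memory g c)(3 := 1, 3 := 0))) \<in> cstep"
    unfolding simulate_def by (rule cstep_While_Suc) simp
  also have "(([?body, simulate], (memory g c)(3 := 1, 3 := 0)), (offering g c, memory g c)) \<in> cstep\<^sup>*"
    unfolding m
  proof (rule csteps_Seq_exec)
    show "exec (compile vars 5 e_offer) (memory g c) ((memory g c)(5 := ?v))"
      using exec_compile_memory[of e_offer g c 0] by (simp only: memory_4)
    show "(([switch 5 bound offer_of ;; continue, simulate], (memory g c)(5 := ?v)), (offering g c, memory g c)) \<in> cstep\<^sup>*"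
      using csteps_switch[of "(memory g c)(5 := ?v)" 5 bound offer_of "[continue, simulate]"] assms
      unfolding m fun_upd_same offering_def by (intro csteps_Seq)
  qed
  finally show ?thesis .
qed

lemma csteps_continue:
  "((continue # ks, (memory g c)(4 := i)), (ks, (memory g (eval (args 0 g c i) (e_next (to_nat (blank :: 'd option)))))(3 := 1))) \<in> cstep\<^sup>*"
  unfolding continue_def
  by (rule csteps_Seq_exec[OF exec_compile_memory], rule csteps_Seq_exec[OF exec_clear],
      rule csteps_Seq_exec[OF exec_clear], rule csteps_Seq_exec[OF exec_transfer], simp,
      rule csteps_exec[OF exec_Inc csteps_refl]) (auto simp: memory_def fun_eq_iff)

lemma csteps_prepare:
  "(([prepare], memory g 0), ([simulate], (memory g (eval (args 0 g 0 0) (e_init (to_nat (blank :: 'd option)))))(3 := 1))) \<in> cstep\<^sup>*"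
proof -
  have "exec (compile vars 5 e) (memory g 0) ((memory g 0)(5 := eval (args 0 g 0 0) e))" for e
    using exec_compile_memory[of e g 0 0] by (simp only: memory_4)
  then show ?thesis
    unfolding prepare_def
    by (rule csteps_Seq_exec, intro csteps_Seq_exec[OF exec_transfer] csteps_Seq_exec[OF exec_Inc csteps_refl])
       (auto simp: memory_def fun_eq_iff)
qed

definition receiving :: "('a, 'c, 'd) action com list" where
  "receiving = [Offer False 4 [Some (Recv u blank), Some (Recv u (Some mark))],
     IfDec 4 (Inc 1 ;; Inc 3) Skip, While 3 receive, prepare]"

lemma csteps_receive:
  "(([While 3 receive, prepare], (memory g c)(3 := 1)), (receiving, memory g c)) \<in> cstep\<^sup>*"
proof -
  have m: "(memory g c)(3 := 1, 3 := 0) = memory g c"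
    by (auto simp: memory_def)
  have "(([While 3 receive, prepare], (memory g c)(3 := 1)),
      ([receive, While 3 receive, prepare], (memory g c)(3 := 1, 3 := 0))) \<in> cstep"
    by (rule cstep_While_Suc) simp
  also have "(([receive, While 3 receive, prepare], (memory g c)(3 := 1, 3 := 0)), (receiving, memory g c)) \<in> cstep\<^sup>*"
    unfolding m receiving_def receive_def by (rule csteps_Seq[OF rtrancl_refl])
  finally show ?thesis .
qed

lemma instr_of_receiving:
  "instr_of receiving = IOffer False [(Some (Recv u blank), tl receiving), (Some (Recv u (Some mark)), Inc 4 # tl receiving)]"
  by (simp add: receiving_def upt_rec)

lemma csteps_mark:
  "((Inc 4 # tl receiving, memory g 0), (receiving, memory (Suc g) 0)) \<in> cstep\<^sup>*"
proof -
  have "((Inc 4 # tl receiving, memory g 0), ([While 3 receive, prepare], (memory (Suc g) 0)(3 := 1))) \<in> cstep\<^sup>*"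
    unfolding receiving_def list.sel
    by (rule csteps_exec[OF exec_Inc], rule csteps_exec[OF exec_IfDec_Suc[OF _ exec_Seq[OF exec_Inc exec_Inc]] csteps_refl])
       (auto simp: memory_def fun_eq_iff)
  then show ?thesis
    using csteps_receive by (rule rtrancl_trans)
qed

lemma csteps_blank: "((tl receiving, memory g 0), ([prepare], memory g 0)) \<in> cstep\<^sup>*"
  unfolding receiving_def list.sel
  by (rule csteps_exec[OF exec_IfDec_zero[OF _ exec_Skip]], simp add: memory_def,
      rule csteps_exec[OF exec_While_zero csteps_refl]) (simp_all add: memory_def)

lemma csteps_main: "(([main], \<lambda>_. 0), (receiving, memory 0 0)) \<in> cstep\<^sup>*"
proof -
  have "(([main], \<lambda>_. 0), ([While 3 receive, prepare], (memory 0 0)(3 := 1))) \<in> cstep\<^sup>*"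
    unfolding main_def
    by (rule csteps_Seq_exec[OF exec_Inc], rule csteps_Seq[OF csteps_refl]) (auto simp: memory_def)
  then show ?thesis
    using csteps_receive by (rule rtrancl_trans)
qed

section \<open>Composition with the sender\<close>

abbreviation blank_tape :: "'d tape" where "blank_tape \<equiv> Tape [] blank []"

abbreviation system :: "('a, 'c, 'd) rtm \<Rightarrow> ((nat \<times> 'd tape) \<times> (nat \<times> 'd tape), ('a, 'c, 'd) action) ts" where
  "system M \<equiv> par {u} (ts_of (Snd u M)) (ts_of rm)"

abbreviation message :: "('a, 'c, 'd) rtm \<Rightarrow> 'd option list" where
  "message M \<equiv> unary (godel M)"

lemma transitions_par:
  "((s1, s2), a, (t1, t2)) \<in> transitions (par C T1 T2) \<longleftrightarrow>
    s1 \<in> states T1 \<and> s2 \<in> states T2 \<and> t1 \<in> states T1 \<and> t2 \<in> states T2 \<and>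
    a \<notin> Some ` comm_actions C \<and>
    ((s1, a, t1) \<in> transitions T1 \<and> t2 = s2 \<or>
     (s2, a, t2) \<in> transitions T2 \<and> t1 = s1 \<or>
     a = tau \<and> (\<exists>c \<in> C. \<exists>d.
       (s1, Some (Send c d), t1) \<in> transitions T1 \<and> (s2, Some (Recv c d), t2) \<in> transitions T2 \<or>
       (s1, Some (Recv c d), t1) \<in> transitions T1 \<and> (s2, Some (Send c d), t2) \<in> transitions T2))"
  by (simp add: par_def)

lemma transitions_Snd:
  "((i, blank_tape), a, y) \<in> transitions (ts_of (Snd u M)) \<longleftrightarrow>
    i < length (message M) \<and> a = Some (Send u (message M ! i)) \<and> y = (Suc i, blank_tape)"
proof -
  have "move MoveR blank blank_tape = blank_tape"
    using Tape_blank_left[of 1 "[]" blank "[]"] by (simp add: move_Tape right_of_def)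
  then show ?thesis
    by (auto simp: transitions_ts_of Snd_def Let_def)
qed

lemma states_Snd: "i \<le> length (message M) \<Longrightarrow> (i, blank_tape) \<in> states (ts_of (Snd u M))"
  by (simp add: ts_of_def Snd_def Let_def)

lemma Send_comm: "Some (Send u d) \<in> Some ` comm_actions {u}" "Some (Recv u d) \<in> Some ` comm_actions {u}"
  by (auto simp: comm_actions_def)

text \<open>A machine state with only a silent step accepts nothing from the sender, and the
  sender's own actions are blocked on \<open>u\<close>, so no other step arises.\<close>

lemma det_system:
  assumes "i \<le> length (message M)" "(x, y) \<in> det (ts_of rm)"
  shows "(((i, blank_tape), x), ((i, blank_tape), y)) \<in> det (system M)"
proof -
  have x: "(x, a, z) \<in> transitions (ts_of rm) \<longleftrightarrow> a = tau \<and> z = y" for a z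
    using assms(2) by (cases z) (auto simp: det_def)
  then have "x \<in> states (ts_of rm)" "y \<in> states (ts_of rm)"
    using ts_of_states[OF is_rtm_rm, of x tau y] by auto
  then have "(((i, blank_tape), x), a, z) \<in> transitions (system M) \<longleftrightarrow> a = tau \<and> z = ((i, blank_tape), y)" for a z
    using states_Snd[OF assms(1)] Send_comm
    by (cases z) (auto simp: transitions_par transitions_Snd x)
  moreover have "((i, blank_tape), x) \<notin> finals (system M)"
    using assms(2) by (simp add: det_def par_def)
  ultimately show ?thesis
    unfolding det_def by blast
qed

lemma run_system:
  assumes "(x, y) \<in> run" "i \<le> length (message M)"
  shows "(((i, blank_tape), x), ((i, blank_tape), y)) \<in> (det (system M))\<^sup>*"
  using assms(1)
  by (induction rule: rtrancl_induct) (auto intro: rtrancl_into_rtrancl det_system[OF assms(2)])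

text \<open>After the message the sender has no steps left, so the composition differs from the
  machine alone only by the blocked actions on \<open>u\<close>.\<close>

lemma transitions_system_end:
  assumes "x \<in> states (ts_of rm)"
  shows "(((length (message M), blank_tape), x), a, z) \<in> transitions (system M) \<longleftrightarrow>
    (\<exists>y. z = ((length (message M), blank_tape), y) \<and> (x, a, y) \<in> transitions (ts_of rm) \<and>
      a \<notin> Some ` comm_actions {u})"
proof -
  obtain t y where "z = (t, y)" by (cases z)
  then show ?thesis
    using assms states_Snd[of "length (message M)" M] ts_of_states[OF is_rtm_rm, of x a y]
    by (auto simp: transitions_par transitions_Snd)
qed

lemma message_nth:
  "i < godel M \<Longrightarrow> message M ! i = Some mark" "message M ! godel M = blank"
  "length (message M) = Suc (godel M)"
  by (simp_all add: unary_def mark_def nth_append)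

text \<open>Neither side can move alone, since both offer only actions on \<open>u\<close>. The
  sender fixes the symbol, so exactly one synchronisation remains, and reception is silent and
  deterministic.\<close>

lemma det_receive:
  assumes "i < length (message M)" "receiving \<in> Q"
  shows "(((i, blank_tape), home receiving s),
    ((Suc i, blank_tape), conf (Back (if message M ! i = blank then tl receiving else Inc 4 # tl receiving)) (cells s) 1))
    \<in> det (system M)"
proof -
  define y where "y = conf (Back (if message M ! i = blank then tl receiving else Inc 4 # tl receiving)) (cells s) 1"
  have nth: "message M ! i = blank \<or> message M ! i = Some mark"
    using assms(1) message_nth(1)[of i M] message_nth(2,3)[of M] by (auto simp: less_Suc_eq)
  have trans: "(home receiving s, a, z) \<in> transitions (ts_of rm) \<longleftrightarrow>
      a = Some (Recv u blank) \<and> z = conf (Back (tl receiving)) (cells s) 1 \<or>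
      a = Some (Recv u (Some mark)) \<and> z = conf (Back (Inc 4 # tl receiving)) (cells s) 1" for a z
    unfolding transitions_offer[OF assms(2) instr_of_receiving] by auto
  have y: "(home receiving s, Some (Recv u (message M ! i)), z) \<in> transitions (ts_of rm) \<longleftrightarrow> z = y" for z
    unfolding trans y_def using nth by auto
  then have st: "home receiving s \<in> states (ts_of rm)" "y \<in> states (ts_of rm)"
    using ts_of_states[OF is_rtm_rm, of "home receiving s" "Some (Recv u (message M ! i))" y] by auto
  have vis: "(home receiving s, tau, z) \<notin> transitions (ts_of rm)"
    "(home receiving s, a, z) \<in> transitions (ts_of rm) \<Longrightarrow> a \<in> Some ` comm_actions {u}" for a z
    unfolding trans using Send_comm by auto
  have "(((i, blank_tape), home receiving s), a, z) \<in> transitions (system M) \<longleftrightarrow>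
      a = tau \<and> z = ((Suc i, blank_tape), y)" for a z
  proof -
    obtain t z' where Pair: "z = (t, z')" by (cases z)
    have "(((i, blank_tape), home receiving s), a, z) \<in> transitions (system M) \<longleftrightarrow>
        a = tau \<and> t = (Suc i, blank_tape) \<and> z' = y"
      unfolding Pair transitions_par transitions_Snd
      using st assms(1) states_Snd[of i M] states_Snd[of "Suc i" M] vis(1)[of z'] vis(2)[of a z'] y[of z'] Send_comm by auto
    then show ?thesis using Pair by simp
  qed
  moreover have "((i, blank_tape), home receiving s) \<notin> finals (system M)"
    using home_final[OF assms(2), of s] instr_of_receiving by (simp add: par_def)
  ultimately show ?thesis
    unfolding det_def y_def by blast
qed

lemma receiving_Q: "receiving \<in> Q"
  using csteps_run[OF csteps_main q0] by simp

lemma tl_receiving_Q: "tl receiving \<in> Q" "Inc 4 # tl receiving \<in> Q"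
  using succs_Q[OF receiving_Q] by (auto simp: instr_of_receiving)

lemma run_receive:
  assumes "i \<le> godel M"
  shows "(start (system M), ((i, blank_tape), home receiving (memory i 0))) \<in> (det (system M))\<^sup>*"
  using assms
proof (induction i)
  case 0
  have "(start (ts_of rm), home receiving (memory 0 0)) \<in> run"
    using run_start csteps_run[OF csteps_main q0] by (meson rtrancl_trans)
  from run_system[OF this, of 0 M] show ?case
    by (simp add: par_def ts_of_def Snd_def Let_def)
next
  case (Suc i)
  then have "(start (system M), ((i, blank_tape), home receiving (memory i 0))) \<in> (det (system M))\<^sup>*"
    by simp
  also have "(((i, blank_tape), home receiving (memory i 0)),
      ((Suc i, blank_tape), conf (Back (Inc 4 # tl receiving)) (cells (memory i 0)) 1)) \<in> det (system M)"
    using det_receive[OF _ receiving_Q, of i M "memory i 0"] Suc.prems message_nth(1)[of i M] message_nth(3)[of M] by simp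
  also have "(((Suc i, blank_tape), conf (Back (Inc 4 # tl receiving)) (cells (memory i 0)) 1),
      ((Suc i, blank_tape), home receiving (memory (Suc i) 0))) \<in> (det (system M))\<^sup>*"
  proof (rule run_system)
    show "(conf (Back (Inc 4 # tl receiving)) (cells (memory i 0)) 1, home receiving (memory (Suc i) 0)) \<in> run"
      using run_Back[OF tl_receiving_Q(2)] csteps_run[OF csteps_mark tl_receiving_Q(2)]
      by (meson rtrancl_trans)
  qed (use Suc.prems message_nth in simp)
  finally show ?case .
qed

lemma run_received:
  "[simulate] \<in> Q \<and> (start (system M), ((length (message M), blank_tape),
    home [simulate] ((memory (godel M) (eval (args 0 (godel M) 0 0) (e_init (to_nat (blank :: 'd option)))))(3 := 1))))
    \<in> (det (system M))\<^sup>*"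
proof -
  let ?g = "godel M"
  let ?s = "(memory ?g (eval (args 0 ?g 0 0) (e_init (to_nat (blank :: 'd option)))))(3 := 1)"
  have "(start (system M), ((?g, blank_tape), home receiving (memory ?g 0))) \<in> (det (system M))\<^sup>*"
    by (rule run_receive) simp
  also have "(((?g, blank_tape), home receiving (memory ?g 0)),
      ((Suc ?g, blank_tape), conf (Back (tl receiving)) (cells (memory ?g 0)) 1)) \<in> det (system M)"
    using det_receive[OF _ receiving_Q, of ?g M "memory ?g 0"] message_nth(2,3)[of M] by simp
  finally have 1: "(start (system M), ((Suc ?g, blank_tape), conf (Back (tl receiving)) (cells (memory ?g 0)) 1))
    \<in> (det (system M))\<^sup>*" .
  have 2: "[simulate] \<in> Q \<and> (home (tl receiving) (memory ?g 0), home [simulate] ?s) \<in> run"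
    using csteps_run[OF rtrancl_trans[OF csteps_blank csteps_prepare] tl_receiving_Q(1)] .
  have "(((Suc ?g, blank_tape), conf (Back (tl receiving)) (cells (memory ?g 0)) 1),
      ((Suc ?g, blank_tape), home [simulate] ?s)) \<in> (det (system M))\<^sup>*"
  proof (rule run_system)
    show "(conf (Back (tl receiving)) (cells (memory ?g 0)) 1, home [simulate] ?s) \<in> run"
      using run_Back[OF tl_receiving_Q(1)] 2 by (meson rtrancl_trans)
  qed (simp add: message_nth)
  with 1 2 show ?thesis
    unfolding message_nth by (meson rtrancl_trans)
qed

end

section \<open>Simulation of a fixed machine\<close>

locale simulated = universal A u B for A :: "('a::countable, 'c::finite, 'd::finite) action set" and u B +
  fixes M :: "('a, 'c, 'd) rtm"
  assumes rtm: "is_rtm A M" and branching: "branching_bounded B (ts_of M)"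
    and no_comm: "s \<in> reachable (ts_of M) \<Longrightarrow> (s, Some a, t) \<in> transitions (ts_of M) \<Longrightarrow> a \<notin> comm_actions {u}"
begin

definition moves :: "nat \<Rightarrow> 'd raw_tape \<Rightarrow> nat list" where
  "moves s x = enabled (proj 1 (godel M)) (config_code s x)"

definition move_labels :: "nat \<Rightarrow> 'd raw_tape \<Rightarrow> ('a, 'c, 'd) action option list" where
  "move_labels s x = map (from_nat \<circ> proj 2) (moves s x)"

lemma set_moves: "set (moves s (l, d, r)) = trans_code ` {x \<in> rtrans M. \<exists>y. x = (s, d, y)}"
  unfolding moves_def by (rule set_enabled[OF finite_A rtm])

text \<open>The link between a chosen index and the transition it stands for: label and successor
  are read off the same list \<open>moves\<close>.\<close>

lemma move_nth:
  assumes "i < length (moves s (l, d, r))" "moves s (l, d, r) ! i = trans_code (s, d, a, e, X, t)"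
  shows "move_labels s (l, d, r) ! i = a"
    "eval (args 0 (godel M) (config_code s (l, d, r)) i) (e_next (to_nat (blank :: 'd option))) =
       config_code t (raw_move X e (l, d, r))"
proof -
  show "move_labels s (l, d, r) ! i = a"
    using assms by (simp add: move_labels_def)
  show "eval (args 0 (godel M) (config_code s (l, d, r)) i) (e_next (to_nat (blank :: 'd option))) =
       config_code t (raw_move X e (l, d, r))"
    using assms eval_next[of "args 0 (godel M) (config_code s (l, d, r)) i" "to_nat (blank :: 'd option)"]
      eval_update[OF refl, of s d a e X t l r]
    by (simp add: moves_def del: config_code.simps trans_code.simps)
qed

lemma offering_eq:
  assumes "s \<in> rstates M"
  shows "eval (args 0 (godel M) (config_code s x) 0) e_offer \<le> bound"
    "offering (godel M) (config_code s x) = [Offer (s \<in> rfinals M) 4 (move_labels s x), continue, simulate]"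
proof -
  obtain l d r where x: "x = (l, d, r)" by (cases x)
  have labels: "a \<in> labels" if "(s, d, a, y) \<in> rtrans M" for s d a y
    using that rtm by (auto simp: is_rtm_def labels_def)
  \<comment> \<open>\<open>from_nat\<close> inverts \<open>to_nat\<close> only on actual codes;
    every listed number is a transition code of \<open>M\<close>, so its label component is
    one.\<close>
  have to_nat: "to_nat (from_nat (proj 2 m) :: ('a, 'c, 'd) action option) = proj 2 m"
    and lab: "from_nat (proj 2 m) \<in> labels" if "m \<in> set (moves s x)" for m
    using that labels unfolding x set_moves by auto
  have "map to_nat (move_labels s x) = map (proj 2) (moves s x)"
    using to_nat by (simp add: move_labels_def)
  moreover have "proj 0 (config_code s x) = s"
    by (simp add: x)
  ultimately have eq: "eval (args 0 (godel M) (config_code s x) 0) e_offer =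
      offer_code (s \<in> rfinals M) (move_labels s x)"
    unfolding eval_offer offer_code_def
    by (simp add: proj_godel[OF finite_A rtm] moves_def del: list_encode.simps)
  have "set (move_labels s x) \<subseteq> labels"
    using lab by (auto simp: move_labels_def)
  moreover have "length (move_labels s x) \<le> B"
    using length_enabled[OF finite_A rtm branching assms] by (simp add: move_labels_def moves_def x del: config_code.simps)
  ultimately show "eval (args 0 (godel M) (config_code s x) 0) e_offer \<le> bound"
    "offering (godel M) (config_code s x) = [Offer (s \<in> rfinals M) 4 (move_labels s x), continue, simulate]"
    unfolding eq offering_def by (simp_all add: offer_code_le offer_of)
qed

definition rep_state :: "nat \<Rightarrow> 'd raw_tape \<Rightarrow> (nat \<times> 'd tape) \<times> (nat \<times> 'd tape)" where
  "rep_state s x = ((length (message M), blank_tape),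
     home (offering (godel M) (config_code s x)) (memory (godel M) (config_code s x)))"

text \<open>Every raw representative of a tape has its own entry, so the code may depend on the
  history of the tape. Reachability makes \<open>no_comm\<close> available, since an action on
  \<open>u\<close> would be blocked in the composition; membership in \<open>Q\<close> gives access
  to the steps of the machine.\<close>

definition Rep :: "((nat \<times> 'd tape) \<times> ((nat \<times> 'd tape) \<times> (nat \<times> 'd tape))) set" where
  "Rep = {((s, Tape l d r), rep_state s (l, d, r)) | s l d r.
     s \<in> rstates M \<and> (s, Tape l d r) \<in> reachable (ts_of M) \<and> offering (godel M) (config_code s (l, d, r)) \<in> Q}"

lemma run_simulate:
  fixes x :: "'d raw_tape"
  assumes "s \<in> rstates M" "[simulate] \<in> Q"
  shows "offering (godel M) (config_code s x) \<in> Q \<and>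
    (home [simulate] ((memory (godel M) (config_code s x))(3 := 1)),
     home (offering (godel M) (config_code s x)) (memory (godel M) (config_code s x))) \<in> run"
  using csteps_run[OF csteps_simulate[OF offering_eq(1)[OF assms(1), of x]] assms(2)] .

lemma run_next:
  assumes "s \<in> rstates M" "t \<in> rstates M" "offering (godel M) (config_code s x) \<in> Q"
    "i < length (move_labels s x)"
    "eval (args 0 (godel M) (config_code s x) i) (e_next (to_nat (blank :: 'd option))) = config_code t y"
  shows "offering (godel M) (config_code t y) \<in> Q"
    "(((length (message M), blank_tape), conf (Back (replicate i (Inc 4) @ [continue, simulate]))
       (cells (memory (godel M) (config_code s x))) 1), rep_state t y) \<in> (det (system M))\<^sup>*"
proof -
  let ?m = "memory (godel M) (config_code s x)" and ?q = "replicate i (Inc 4) @ [continue, simulate]"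
  have q: "?q \<in> Q"
    using succs_Q[OF assms(3)] assms(4) by (auto simp: offering_eq(2)[OF assms(1)] image_subset_iff)
  have "((?q, ?m), ([continue, simulate], ?m(4 := i))) \<in> cstep\<^sup>*"
    using csteps_replicate[of i 4 "[continue, simulate]" ?m] by (simp add: memory_def)
  also have "(([continue, simulate], ?m(4 := i)), ([simulate], (memory (godel M) (config_code t y))(3 := 1))) \<in> cstep\<^sup>*"
    using csteps_continue[of "[simulate]"] unfolding assms(5)[symmetric] .
  also have "(([simulate], (memory (godel M) (config_code t y))(3 := 1)),
      (offering (godel M) (config_code t y), memory (godel M) (config_code t y))) \<in> cstep\<^sup>*"
    by (rule csteps_simulate[OF offering_eq(1)[OF assms(2)]])
  finally have run: "offering (godel M) (config_code t y) \<in> Q \<and>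
      (home ?q ?m, home (offering (godel M) (config_code t y)) (memory (godel M) (config_code t y))) \<in> run"
    using q by (rule csteps_run)
  then show "offering (godel M) (config_code t y) \<in> Q" ..
  show "(((length (message M), blank_tape), conf (Back ?q) (cells ?m) 1), rep_state t y) \<in> (det (system M))\<^sup>*"
    unfolding rep_state_def
    by (rule run_system) (use run run_Back[OF q] in \<open>auto intro: rtrancl_trans\<close>)
qed

text \<open>Branches are indexed by positions in the menu rather than by labels, so two transitions
  of \<open>M\<close> with equal labels stay distinct.\<close>

lemma transitions_rep_state:
  assumes "s \<in> rstates M" "offering (godel M) (config_code s x) \<in> Q"
  shows "(rep_state s x, a, z) \<in> transitions (system M) \<longleftrightarrow> a \<notin> Some ` comm_actions {u} \<and>
    (\<exists>i < length (move_labels s x). a = move_labels s x ! i \<and>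
       z = ((length (message M), blank_tape), conf (Back (replicate i (Inc 4) @ [continue, simulate]))
         (cells (memory (godel M) (config_code s x))) 1))"
proof -
  have instr: "instr_of (offering (godel M) (config_code s x)) = IOffer (s \<in> rfinals M)
      (map (\<lambda>i. (move_labels s x ! i, replicate i (Inc 4) @ [continue, simulate])) [0..<length (move_labels s x)])"
    by (simp add: offering_eq(2)[OF assms(1)])
  have set: "(a, q') \<in> set (map (\<lambda>i. (move_labels s x ! i, replicate i (Inc 4) @ [continue, simulate])) [0..<length (move_labels s x)])
      \<longleftrightarrow> (\<exists>i < length (move_labels s x). a = move_labels s x ! i \<and> q' = replicate i (Inc 4) @ [continue, simulate])"
    for q' by auto
  show ?thesis
    unfolding rep_state_def transitions_system_end[OF home_states[OF assms(2)]]
      transitions_offer[OF assms(2) instr] set by (auto simp del: split_paired_Ex)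
qed

lemma rstates_reachable:
  assumes "(s, x) \<in> reachable (ts_of M)" shows "s \<in> rstates M"
proof -
  have "(s, x) = start (ts_of M) \<or> (s, x) \<in> states (ts_of M)"
    using assms ts_of_states(2)[OF rtm] unfolding reachable_def
    by (auto elim: rtranclE simp: step_rel_def)
  then show ?thesis
    using rtm by (auto simp: ts_of_def is_rtm_def)
qed

lemma reachable_step:
  "x \<in> reachable (ts_of M) \<Longrightarrow> (x, a, y) \<in> transitions (ts_of M) \<Longrightarrow> y \<in> reachable (ts_of M)"
  unfolding reachable_def step_rel_def by (auto intro: rtrancl_into_rtrancl)

text \<open>The common core of both directions: forwards the index is found from the transition,
  backwards the transition from the index.\<close>

lemma Rep_next:
  assumes "(s, d, a, e, X, t) \<in> rtrans M" "s \<in> rstates M" "(s, Tape l d r) \<in> reachable (ts_of M)"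
    "offering (godel M) (config_code s (l, d, r)) \<in> Q"
    "i < length (moves s (l, d, r))" "moves s (l, d, r) ! i = trans_code (s, d, a, e, X, t)"
  shows "((s, Tape l d r), a, (t, move X e (Tape l d r))) \<in> transitions (ts_of M)"
    "\<exists>z. (((length (message M), blank_tape), conf (Back (replicate i (Inc 4) @ [continue, simulate]))
       (cells (memory (godel M) (config_code s (l, d, r)))) 1), z) \<in> (det (system M))\<^sup>* \<and>
       ((t, move X e (Tape l d r)), z) \<in> Rep"
proof -
  show trans: "((s, Tape l d r), a, (t, move X e (Tape l d r))) \<in> transitions (ts_of M)"
    using assms(1) by (auto simp: transitions_ts_of)
  have t: "(t, move X e (Tape l d r)) \<in> reachable (ts_of M)"
    by (rule reachable_step[OF assms(3) trans])
  obtain l' d' r' where y: "raw_move X e (l, d, r) = (l', d', r')" by (metis prod_cases3)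
  have "t \<in> rstates M" by (rule rstates_reachable[OF t])
  note run = run_next[OF assms(2) this assms(4) _ move_nth(2)[OF assms(5,6)]]
  have "i < length (move_labels s (l, d, r))"
    using assms(5) by (simp add: move_labels_def)
  note run = run[OF this]
  have "move X e (Tape l d r) = Tape l' d' r'"
    by (simp add: move_Tape_raw y)
  then have "((t, move X e (Tape l d r)), rep_state t (l', d', r')) \<in> Rep"
    unfolding Rep_def using run(1) \<open>t \<in> rstates M\<close> t by (simp only: y) blast
  with run(2) show "\<exists>z. (((length (message M), blank_tape), conf (Back (replicate i (Inc 4) @ [continue, simulate]))
       (cells (memory (godel M) (config_code s (l, d, r)))) 1), z) \<in> (det (system M))\<^sup>* \<and>
       ((t, move X e (Tape l d r)), z) \<in> Rep"
    unfolding y by blast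
qed

sublocale simulation "ts_of M" "system M" Rep
proof
  show "Rep \<subseteq> states (ts_of M) \<times> states (system M)"
  proof
    fix p assume "p \<in> Rep"
    then obtain s l d r where p: "p = ((s, Tape l d r), rep_state s (l, d, r))" "s \<in> rstates M"
      "offering (godel M) (config_code s (l, d, r)) \<in> Q"
      unfolding Rep_def by blast
    then show "p \<in> states (ts_of M) \<times> states (system M)"
      using states_Snd[of "length (message M)" M] home_states[OF p(3)]
      by (simp add: rep_state_def par_def ts_of_def[of M] del: config_code.simps)
  qed
  show "x \<in> states (system M)" if "(x, a, x') \<in> transitions (system M)" for x a x'
    using that by (auto simp: par_def)
next
  fix m y a m' assume "(m, y) \<in> Rep" and trans: "(m, a, m') \<in> transitions (ts_of M)"
  then obtain s l d r where m: "m = (s, Tape l d r)" "y = rep_state s (l, d, r)" "s \<in> rstates M"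
    "(s, Tape l d r) \<in> reachable (ts_of M)" "offering (godel M) (config_code s (l, d, r)) \<in> Q"
    unfolding Rep_def by blast
  from trans obtain e X t where step: "(s, d, a, e, X, t) \<in> rtrans M" "m' = (t, move X e (Tape l d r))"
    by (auto simp: m(1) transitions_ts_of)
  then have "trans_code (s, d, a, e, X, t) \<in> set (moves s (l, d, r))"
    by (auto simp: set_moves simp del: trans_code.simps)
  then obtain i where i: "i < length (moves s (l, d, r))" "moves s (l, d, r) ! i = trans_code (s, d, a, e, X, t)"
    unfolding in_set_conv_nth by blast
  have "a \<notin> Some ` comm_actions {u}"
    using no_comm[OF m(4), of _ m'] trans m(1) by blast
  then have "(y, a, ((length (message M), blank_tape), conf (Back (replicate i (Inc 4) @ [continue, simulate]))
       (cells (memory (godel M) (config_code s (l, d, r)))) 1)) \<in> transitions (system M)"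
    unfolding m(2) transitions_rep_state[OF m(3,5)] using i move_nth(1)[OF i]
    by (auto simp: move_labels_def)
  with Rep_next(2)[OF step(1) m(3,4,5) i]
  show "\<exists>y' z. (y, a, y') \<in> transitions (system M) \<and> (y', z) \<in> (det (system M))\<^sup>* \<and> (m', z) \<in> Rep"
    unfolding step(2) by blast
next
  fix m y a y' assume "(m, y) \<in> Rep" and trans: "(y, a, y') \<in> transitions (system M)"
  then obtain s l d r where m: "m = (s, Tape l d r)" "y = rep_state s (l, d, r)" "s \<in> rstates M"
    "(s, Tape l d r) \<in> reachable (ts_of M)" "offering (godel M) (config_code s (l, d, r)) \<in> Q"
    unfolding Rep_def by blast
  from trans obtain i where i: "i < length (moves s (l, d, r))" "a = move_labels s (l, d, r) ! i"
    and y': "y' = ((length (message M), blank_tape), conf (Back (replicate i (Inc 4) @ [continue, simulate]))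
         (cells (memory (godel M) (config_code s (l, d, r)))) 1)"
    unfolding m(2) transitions_rep_state[OF m(3,5)] by (auto simp: move_labels_def)
  have "moves s (l, d, r) ! i \<in> trans_code ` {x \<in> rtrans M. \<exists>y. x = (s, d, y)}"
    using nth_mem[OF i(1)] unfolding set_moves .
  then obtain b e X t where step: "(s, d, b, e, X, t) \<in> rtrans M"
    "moves s (l, d, r) ! i = trans_code (s, d, b, e, X, t)"
    by (auto simp del: trans_code.simps)
  have "b = a" using i(2) move_nth(1)[OF i(1) step(2)] by simp
  from Rep_next[OF step(1) m(3,4,5) i(1) step(2)]
  show "\<exists>m' z. (m, a, m') \<in> transitions (ts_of M) \<and> (y', z) \<in> (det (system M))\<^sup>* \<and> (m', z) \<in> Rep"
    unfolding m(1) y' \<open>b = a\<close> by blast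
next
  fix m y assume "(m, y) \<in> Rep"
  then obtain s l d r where m: "m = (s, Tape l d r)" "y = rep_state s (l, d, r)" "s \<in> rstates M"
    "(s, Tape l d r) \<in> reachable (ts_of M)" "offering (godel M) (config_code s (l, d, r)) \<in> Q"
    unfolding Rep_def by blast
  have "(length (message M), blank_tape) \<in> finals (ts_of (Snd u M))"
    by (simp add: ts_of_def Snd_def Let_def)
  then show "m \<in> finals (ts_of M) \<longleftrightarrow> y \<in> finals (system M)"
    using home_final[OF m(5)] by (simp add: m(1,2) rep_state_def par_def offering_eq(2)[OF m(3)] ts_of_def[of M] del: config_code.simps)
qed

lemma dpbb_equiv: "dpbb_equiv (ts_of M) (system M)"
proof (rule dpbb_equiv_if_start)
  let ?x = "([], blank, []) :: 'd raw_tape"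
  have init: "rinit M \<in> rstates M" using rtm by (simp add: is_rtm_def)
  have eq: "eval (args 0 (godel M) 0 0) (e_init (to_nat (blank :: 'd option))) = config_code (rinit M) ?x"
    by (rule eval_init) simp
  from run_received[of M] have 1: "[simulate] \<in> Q"
    "(start (system M), ((length (message M), blank_tape),
      home [simulate] ((memory (godel M) (config_code (rinit M) ?x))(3 := 1)))) \<in> (det (system M))\<^sup>*"
    unfolding eq by blast+
  from run_simulate[OF init 1(1), of ?x]
  have 2: "offering (godel M) (config_code (rinit M) ?x) \<in> Q"
    "(((length (message M), blank_tape), home [simulate] ((memory (godel M) (config_code (rinit M) ?x))(3 := 1))),
      rep_state (rinit M) ?x) \<in> (det (system M))\<^sup>*"
    unfolding rep_state_def by (auto intro: run_system)
  show "(start (system M), rep_state (rinit M) ?x) \<in> (det (system M))\<^sup>*"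
    using 1(2) 2(2) by (rule rtrancl_trans)
  have start: "start (ts_of M) = (rinit M, blank_tape)"
    by (simp add: ts_of_def)
  then have "(rinit M, blank_tape) \<in> reachable (ts_of M)"
    by (simp add: reachable_def)
  then show "(start (ts_of M), rep_state (rinit M) ?x) \<in> Rep"
    unfolding start Rep_def using init 2(1) by blast
qed

end

theorem theorem2:
  fixes A :: "('a::countable, 'c::finite, 'd::finite) action set" and u :: 'c and B :: nat
  assumes "finite A" and "comm_actions UNIV \<subseteq> A"
  shows "\<exists>U. is_rtm A U \<and>
    (\<forall>M. is_rtm A M \<and> branching_bounded B (ts_of M) \<and>
         (\<forall>s \<in> reachable (ts_of M). \<forall>a t. (s, Some a, t) \<in> transitions (ts_of M) \<longrightarrow> a \<notin> comm_actions {u})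
       \<longrightarrow> dpbb_equiv (ts_of M) (par {u} (ts_of (Snd u M)) (ts_of U)))"
proof -
  interpret universal A u B
    using assms by unfold_locales
  have "dpbb_equiv (ts_of M) (system M)"
    if "is_rtm A M" "branching_bounded B (ts_of M)"
      "\<forall>s \<in> reachable (ts_of M). \<forall>a t. (s, Some a, t) \<in> transitions (ts_of M) \<longrightarrow> a \<notin> comm_actions {u}" for M
  proof -
    interpret simulated A u B M
      using that by unfold_locales auto
    show ?thesis by (rule dpbb_equiv)
  qed
  then show ?thesis
    using is_rtm_rm by blast
qed

end
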